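(* Let $J,R,Q\in\mathbb{R}^{n\times n}$, $B,P\in\mathbb{R}^{n\times m}$, $D\in\mathbb{R}^{m\times m}$ with $J=-J^\top$, $R=R^\top\ge0$, $Q=Q^\top\ge0$, $S:=\tfrac12(D+D^\top)\ge0$, and $W:=\begin{pmatrix}QRQ & QP \\ P^\top Q & S\end{pmatrix}\ge0$, $W\ne0$. Let $\mathbb{U}\subset\mathbb{R}^m$ be convex and compact with $0\in\operatorname{int}\mathbb{U}$, let $\Phi\subset\mathbb{R}^n$ be closed, and let $x^0\in\mathbb{R}^n$. Consider the optimal control problem $$\min_{u\in L^1(0,T;\mathbb{U})}\tfrac12x(T)^\top Qx(T)+\int_0^T\Big\|W^{1/2}\begin{pmatrix}x(t) \\ u(t)\end{pmatrix}\Big\|^2dt\quad\text{s.t. }\dot x=(J-R)Qx+(B-P)u,\ x(0)=x^0,\ x(T)\in\Phi.\qquad(\mathrm{OCP})$$ Assume that $((J-R)Q,B-P)$ is controllable, that $0\in\mathcal{C}(\Phi)$, and let $T>T(x^0)$, where $T(\cdot)$ is the function defined in the context. Let $(x^\star,u^\star,\lambda^\star)$ satisfy the necessary optimality conditions for (OCP), and assume that $t_c\in(0,T/4)$ is such that $u^\star(t)\in\operatorname{int}\mathbb{U}$ for a.e. $t\in[t_c,T-t_c]$. Then the adjoint state $\lambda^\star$ exhibits an integral turnpike with respect to zero, i.e., there is a continuous function $G:\mathbb{R}^n\to[0,\infty)$ such that $$\int_{2t_c}^{T-t_c}\|\lambda^\star(t)\|^2\,dt\le G(x^0).$$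
   Context: $L^1(0,T;\mathbb{U})$: integrable functions on $[0,T]$ with values in $\mathbb{U}$. $\mathcal{C}(\Phi)$ is the set of states that can be steered into $\Phi$ in some finite time $t\ge0$ along $\dot x=(J-R)Qx+(B-P)u$ by a control $u\in L^1(0,t;\mathbb{U})$. $(A,\tilde B)$ is controllable if $\operatorname{rank}(\tilde B,A\tilde B,\dots,A^{n-1}\tilde B)=n$. The function $T(\cdot):\mathbb{R}^n\to[0,\infty)$: since $0\in\mathcal{C}(\Phi)$, there are a time $T_1>0$ and a control in $L^1(0,T_1;\mathbb{U})$ steering $0$ into $\Phi$ at time $T_1$; fix such a $T_1$. Let $T_0(x^0)$ be the minimal time at which $0$ can be reached from $x^0$ with controls taking values in $\mathbb{U}$ (under controllability this is finite for every $x^0\in\mathbb{R}^n$ and continuous in $x^0$). Then $T(x^0):=T_0(x^0)+T_1$. (This is the time threshold in the integral input-state subspace turnpike property of (OCP) with respect to $\ker W$: for a continuous $F:\mathbb{R}^n\to[0,\infty)$, each optimal pair $(x^\star,u^\star)$ satisfies $\int_0^T\operatorname{dist}^2((x^\star(t),u^\star(t)),\ker W)\,dt\le F(x^0)$ whenever $T>T(x^0)$.) Necessary optimality conditions: put $$\mathcal{H}(x,u,\lambda,\lambda_0)=\lambda^\top\big((J-R)Qx+(B-P)u\big)+\lambda_0\Big\|W^{1/2}\begin{pmatrix}x \\ u\end{pmatrix}\Big\|^2.$$ If $(x^\star,u^\star)\in W^{1,1}(0,T;\mathbb{R}^n)\times L^1(0,T;\mathbb{U})$ is an optimal state-input pair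 of (OCP), then there exist $\lambda^\star\in W^{1,1}(0,T;\mathbb{R}^n)$ and a constant $\lambda_0^\star\le0$ with $(\lambda_0^\star,\lambda^\star(t))\ne0$ for all $t\in[0,T]$ such that for a.e. $t\in[0,T]$: $\dot x^\star(t)=\mathcal{H}_\lambda$, $\dot\lambda^\star(t)=-\mathcal{H}_x$ (both evaluated at $(x^\star(t),u^\star(t),\lambda^\star(t),\lambda_0^\star)$), and $u^\star(t)\in\arg\max_{u\in\mathbb{U}}\mathcal{H}(x^\star(t),u,\lambda^\star(t),\lambda_0^\star)$. These are the necessary optimality conditions; $\lambda^\star$ is the adjoint state, and "$(x^\star,u^\star,\lambda^\star)$ satisfies the necessary optimality conditions" means that they hold with some such constant $\lambda_0^\star$.
   Formalization: The pair (x*,u* ) is additionally assumed to be optimal for (OCP), since without a transversality condition the bound fails for non-optimal triples; G is uniform in x0, T, t_c and the triple, but may depend on the multiplier constant λ0* and on T1. *)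

theory Defs
  imports "HOL-Analysis.Analysis"
begin

definition psd :: "real^'k^'k \<Rightarrow> bool" where
  "psd M \<longleftrightarrow> transpose M = M \<and> (\<forall>z. 0 \<le> z \<bullet> (M *v z))"

(* For psd M there is exactly one such root, so the choice operator does not choose anything. *)
definition psd_sqrt :: "real^'k^'k \<Rightarrow> real^'k^'k" where
  "psd_sqrt M = (SOME V. psd V \<and> V ** V = M)"

definition stack :: "real^'n \<Rightarrow> real^'m \<Rightarrow> real^('n + 'm)" where
  "stack x u = (\<chi> i. case i of Inl a \<Rightarrow> x $ a | Inr b \<Rightarrow> u $ b)"

definition block_matrix ::
    "real^'n^'n \<Rightarrow> real^'m^'n \<Rightarrow> real^'n^'m \<Rightarrow> real^'m^'m \<Rightarrow> real^('n + 'm)^('n + 'm)" where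
  "block_matrix M11 M12 M21 M22 = (\<chi> i j.
     case i of
       Inl a \<Rightarrow> (case j of Inl b \<Rightarrow> M11 $ a $ b | Inr b \<Rightarrow> M12 $ a $ b)
     | Inr a \<Rightarrow> (case j of Inl b \<Rightarrow> M21 $ a $ b | Inr b \<Rightarrow> M22 $ a $ b))"

(* Kalman's rank condition rank (C, A C, ..., A^(n-1) C) = n. The rank is written as the dimension
   of the span of the columns (cf. column_rank_def), so that the columns of the block matrix
   need not be enumerated. The k-fold iterate of (**) A maps C to A^k C; note that the power
   operation on the type of matrices would be componentwise. *)
definition controllable :: "real^'n^'n \<Rightarrow> real^'m^'n \<Rightarrow> bool" where
  "controllable A C \<longleftrightarrow> dim (\<Union>k<CARD('n). columns (((\<lambda>X. A ** X) ^^ k) C)) = CARD('n)"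

(* x belongs to W^{1,1}(0,T) and has weak derivative v; x is the absolutely continuous
   representative, hence x 0 and x T are meaningful, and v is determined up to null sets. *)
definition W11_deriv :: "real \<Rightarrow> (real \<Rightarrow> real^'n) \<Rightarrow> (real \<Rightarrow> real^'n) \<Rightarrow> bool" where
  "W11_deriv T x v \<longleftrightarrow>
     v absolutely_integrable_on {0..T} \<and> (\<forall>t\<in>{0..T}. x t = x 0 + integral {0..t} v)"

definition L1_control :: "(real^'m) set \<Rightarrow> real \<Rightarrow> (real \<Rightarrow> real^'m) \<Rightarrow> bool" where
  "L1_control U T u \<longleftrightarrow>
     u absolutely_integrable_on {0..T} \<and> (AE t in lebesgue_on {0..T}. u t \<in> U)"

definition trajectory ::
    "real^'n^'n \<Rightarrow> real^'m^'n \<Rightarrow> real \<Rightarrow> (real \<Rightarrow> real^'n) \<Rightarrow> (real \<Rightarrow> real^'m) \<Rightarrow> bool" where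
  "trajectory A C T x u \<longleftrightarrow>
     (\<exists>v. W11_deriv T x v \<and> (AE t in lebesgue_on {0..T}. v t = A *v x t + C *v u t))"

definition steerable ::
    "real^'n^'n \<Rightarrow> real^'m^'n \<Rightarrow> (real^'m) set \<Rightarrow> real \<Rightarrow> real^'n \<Rightarrow> (real^'n) set \<Rightarrow> bool" where
  "steerable A C U t x0 \<Phi> \<longleftrightarrow>
     0 \<le> t \<and> (\<exists>x u. L1_control U t u \<and> trajectory A C t x u \<and> x 0 = x0 \<and> x t \<in> \<Phi>)"

definition steerable_set ::
    "real^'n^'n \<Rightarrow> real^'m^'n \<Rightarrow> (real^'m) set \<Rightarrow> (real^'n) set \<Rightarrow> (real^'n) set" where
  "steerable_set A C U \<Phi> = {x0. \<exists>t. steerable A C U t x0 \<Phi>}"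

definition min_time_to_zero ::
    "real^'n^'n \<Rightarrow> real^'m^'n \<Rightarrow> (real^'m) set \<Rightarrow> real^'n \<Rightarrow> real" where
  "min_time_to_zero A C U x0 = Inf {t. steerable A C U t x0 {0}}"

definition running_cost :: "real^('n + 'm)^('n + 'm) \<Rightarrow> real^'n \<Rightarrow> real^'m \<Rightarrow> real" where
  "running_cost W x u = (norm (psd_sqrt W *v stack x u))\<^sup>2"

definition ocp_cost :: "real^'n^'n \<Rightarrow> real^('n + 'm)^('n + 'm) \<Rightarrow> real \<Rightarrow>
    (real \<Rightarrow> real^'n) \<Rightarrow> (real \<Rightarrow> real^'m) \<Rightarrow> real" where
  "ocp_cost Q W T x u =
     1/2 * (x T \<bullet> (Q *v x T)) + integral {0..T} (\<lambda>t. running_cost W (x t) (u t))"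

definition ocp_admissible :: "real^'n^'n \<Rightarrow> real^'m^'n \<Rightarrow> (real^'m) set \<Rightarrow> (real^'n) set \<Rightarrow>
    real^'n \<Rightarrow> real \<Rightarrow> (real \<Rightarrow> real^'n) \<Rightarrow> (real \<Rightarrow> real^'m) \<Rightarrow> bool" where
  "ocp_admissible A C U \<Phi> x0 T x u \<longleftrightarrow>
     L1_control U T u \<and> trajectory A C T x u \<and> x 0 = x0 \<and> x T \<in> \<Phi>"

definition ocp_optimal :: "real^'n^'n \<Rightarrow> real^'m^'n \<Rightarrow> real^'n^'n \<Rightarrow> real^('n + 'm)^('n + 'm) \<Rightarrow>
    (real^'m) set \<Rightarrow> (real^'n) set \<Rightarrow> real^'n \<Rightarrow> real \<Rightarrow>
    (real \<Rightarrow> real^'n) \<Rightarrow> (real \<Rightarrow> real^'m) \<Rightarrow> bool" where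
  "ocp_optimal A C Q W U \<Phi> x0 T x u \<longleftrightarrow>
     ocp_admissible A C U \<Phi> x0 T x u \<and>
     (\<forall>y w. ocp_admissible A C U \<Phi> x0 T y w \<longrightarrow> ocp_cost Q W T x u \<le> ocp_cost Q W T y w)"

definition hamiltonian :: "real^'n^'n \<Rightarrow> real^'m^'n \<Rightarrow> real^('n + 'm)^('n + 'm) \<Rightarrow>
    real^'n \<Rightarrow> real^'m \<Rightarrow> real^'n \<Rightarrow> real \<Rightarrow> real" where
  "hamiltonian A C W x u l l0 = l \<bullet> (A *v x + C *v u) + l0 * running_cost W x u"

(* The conditions for (x, u, l) with the multiplier l0 of the cost. They are invariant under
   multiplying (l, l0) by a positive constant; l0 is not normalised.
   There is no transversality condition, and the end point conditions on x are not included. *)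
definition necessary_conditions :: "real^'n^'n \<Rightarrow> real^'m^'n \<Rightarrow> real^('n + 'm)^('n + 'm) \<Rightarrow>
    (real^'m) set \<Rightarrow> real \<Rightarrow> (real \<Rightarrow> real^'n) \<Rightarrow> (real \<Rightarrow> real^'m) \<Rightarrow> (real \<Rightarrow> real^'n) \<Rightarrow> real \<Rightarrow> bool"
  where
  "necessary_conditions A C W U T x u l l0 \<longleftrightarrow>
     L1_control U T u \<and> l0 \<le> 0 \<and> (\<forall>t\<in>{0..T}. (l0, l t) \<noteq> 0) \<and>
     (\<exists>dx dl. W11_deriv T x dx \<and> W11_deriv T l dl \<and>
        (AE t in lebesgue_on {0..T}.
           GDERIV (\<lambda>p. hamiltonian A C W (x t) (u t) p l0) (l t) :> dx t \<and>
           GDERIV (\<lambda>z. hamiltonian A C W z (u t) (l t) l0) (x t) :> - dl t \<and>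
           is_arg_max (\<lambda>w. hamiltonian A C W (x t) w (l t) l0) (\<lambda>w. w \<in> U) (u t)))"

end

(* Along the interior part of the arc the adjoint equation and the stationarity of the Hamiltonian in
   u say that l is an unforced adjoint solution up to terms that are linear in
   w = psd_sqrt W *v stack x u: for every solution (xi, v) of the control system,
   (l \<bullet> xi)' = - 2 l0 w \<bullet> (psd_sqrt W *v stack xi v). By controllability such a solution can be steered
   between 0 and l t within the fixed time d = T1/4, at a cost proportional to the norm of l t. Hence
   |l t|^2 is bounded by a constant times the integral of |w|^2, the running cost, over a window of
   length d that begins or ends at t, and integration over t yields a constant times the total cost.

   The optimal cost is bounded uniformly in T by that of a competitor that steers x0 to 0, rests there,
   and then steers 0 into Phi. A bound on the time for the first phase that is locally uniform in x0
   comes from dissipativity: uncontrolled solutions grow at most linearly in time. *)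

theory Submission
  imports Defs
begin

text \<open>The difficulty is uniformity: \<open>G\<close> must not depend on \<open>T\<close>,
  \<open>tc\<close> or the optimal triple. Hence the window length \<open>d\<close> is fixed in
  advance, so that the steering constant depends on \<open>d\<close> alone. Putting t at an end of
  its window allows the steered solution to be prescribed there, which isolates the squared norm of
  \<open>l t\<close>. Integration over t costs a factor 2 d rather than T, since each time belongs
  only to windows of points t at distance at most d.

  Null controllability with bounded controls is delicate because Q may be singular, so that the
  stored energy does not bound the state. For R = 0, Q = diag (0, 1) and J the generator of plane
  rotations, A is the double integrator, and free solutions do grow linearly; small controls have to
  outrun this growth.

  In place of the continuity of the minimal time, an explicit continuous majorant serves. The strict
  inequality between T and the minimal time plus \<open>T1\<close> leaves room for a steering time
  that is attained.\<close>

subsection \<open>Linear flows\<close>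

text \<open>The exponential of \<open>t\<close> times \<open>f\<close>, applied to \<open>x\<close>.
  It is set up for linear maps on any Euclidean space because \<open>steering\<close> needs it on
  pairs of a state and a costate.\<close>

definition flow :: "('a::euclidean_space \<Rightarrow> 'a) \<Rightarrow> real \<Rightarrow> 'a \<Rightarrow> 'a" where
  "flow f t x = (\<Sum>k. (t ^ k / fact k) *\<^sub>R (f ^^ k) x)"

lemma norm_funpow_le:
  fixes f :: "'a::real_normed_vector \<Rightarrow> 'a"
  assumes "\<And>x. norm (f x) \<le> b * norm x" "0 \<le> b"
  shows "norm ((f ^^ k) x) \<le> b ^ k * norm x"
proof (induction k)
  case (Suc k)
  have "norm ((f ^^ Suc k) x) \<le> b * norm ((f ^^ k) x)" using assms by simp
  also have "\<dots> \<le> b * (b ^ k * norm x)" using Suc assms by (intro mult_left_mono)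
  finally show ?case by simp
qed simp

context
  fixes f :: "'a::euclidean_space \<Rightarrow> 'a" and b :: real
  assumes lin: "linear f" and bnd: "\<And>x. norm (f x) \<le> b * norm x" and b0: "0 \<le> b"
begin

lemma flow_term_le: "norm ((t ^ k / fact k) *\<^sub>R (f ^^ k) x) \<le> norm x * (inverse (fact k) * (\<bar>t\<bar> * b) ^ k)"
proof -
  have "norm ((t ^ k / fact k) *\<^sub>R (f ^^ k) x) = (\<bar>t\<bar> ^ k / fact k) * norm ((f ^^ k) x)"
    by (simp add: power_abs)
  also have "\<dots> \<le> (\<bar>t\<bar> ^ k / fact k) * (b ^ k * norm x)"
    by (intro mult_left_mono norm_funpow_le bnd b0) auto
  finally show ?thesis by (simp add: field_simps power_mult_distrib)
qed

lemma flow_summable: "summable (\<lambda>k. (t ^ k / fact k) *\<^sub>R (f ^^ k) x)"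
  by (rule summable_comparison_test'[OF summable_mult[OF summable_exp]]) (rule flow_term_le)

lemma norm_flow_le: "norm (flow f t x) \<le> exp (b * \<bar>t\<bar>) * norm x"
proof -
  have s: "summable (\<lambda>k. norm x * (inverse (fact k) * (\<bar>t\<bar> * b) ^ k))"
    by (intro summable_mult summable_exp)
  have "norm (flow f t x) \<le> (\<Sum>k. norm x * (inverse (fact k) * (\<bar>t\<bar> * b) ^ k))"
    unfolding flow_def by (rule norm_suminf_le[OF flow_term_le s])
  also have "\<dots> = norm x * (\<Sum>k. (inverse (fact k) * (\<bar>t\<bar> * b) ^ k))"
    by (intro suminf_mult summable_exp)
  finally show ?thesis by (simp add: exp_def divide_inverse mult_ac scaleR_conv_of_real)
qed

lemma linear_funpow: "linear (f ^^ k)"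
proof (induction k)
  case (Suc k)
  then show ?case using linear_compose[OF Suc lin] by (simp add: o_def)
qed (simp add: linear_id[unfolded id_def])

lemma flow_linear: "linear (flow f t)"
proof (rule linearI)
  fix x y show "flow f t (x + y) = flow f t x + flow f t y"
    unfolding flow_def suminf_add[OF flow_summable flow_summable]
    by (simp add: linear_add[OF linear_funpow] scaleR_right_distrib)
next
  fix c x show "flow f t (c *\<^sub>R x) = c *\<^sub>R flow f t x"
    unfolding flow_def
    by (subst suminf_scaleR_right[OF flow_summable]) (simp add: linear_cmul[OF linear_funpow] mult_ac)
qed

lemma flow_0 [simp]: "flow f 0 x = x"
proof -
  have "(\<lambda>k. (0 ^ k / fact k) *\<^sub>R (f ^^ k) x) = (\<lambda>k. if k = 0 then x else 0)"
    by (auto simp: fun_eq_iff)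
  then show ?thesis unfolding flow_def using suminf_finite[of "{0}" "\<lambda>k. if k = 0 then x else 0"] by simp
qed

lemma flow_comm: "f (flow f t x) = flow f t (f x)"
proof -
  have "f (flow f t x) = (\<Sum>k. f ((t ^ k / fact k) *\<^sub>R (f ^^ k) x))"
    unfolding flow_def
    by (rule bounded_linear.suminf[OF _ flow_summable]) (use lin in \<open>simp add: linear_conv_bounded_linear\<close>)
  then show ?thesis unfolding flow_def by (simp add: linear_cmul[OF lin] funpow_swap1)
qed

text \<open>Each coordinate is a power series in t that converges everywhere, hence may be
  differentiated termwise. The shift of coefficients by \<open>diffs\<close> amounts to one more
  application of \<open>f\<close>.\<close>

lemma flow_has_vector_derivative:
  "((\<lambda>t. flow f t x) has_vector_derivative f (flow f t x)) (at t within s)"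
proof -
  have "((\<lambda>t. flow f t x \<bullet> i) has_field_derivative f (flow f t x) \<bullet> i) (at t)" for i
  proof -
    define c where "c k = ((f ^^ k) x \<bullet> i) / fact k" for k
    have inner_flow: "flow f t y \<bullet> i = (\<Sum>k. ((f ^^ k) y \<bullet> i) / fact k * t ^ k)"
      and inner_summable: "summable (\<lambda>k. ((f ^^ k) y \<bullet> i) / fact k * t ^ k)" for t y
      using bounded_linear.suminf[OF bounded_linear_inner_left[of i] flow_summable[of t y]]
        bounded_linear.summable[OF bounded_linear_inner_left[of i] flow_summable[of t y]]
      by (simp_all add: flow_def mult_ac)
    have "((\<lambda>t. \<Sum>k. c k * t ^ k) has_field_derivative (\<Sum>k. diffs c k * t ^ k)) (at t)"
      by (rule termdiffs_strong_converges_everywhere) (use inner_summable in \<open>simp add: c_def\<close>)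
    moreover have "diffs c k = ((f ^^ k) (f x) \<bullet> i) / fact k" for k
      by (simp add: diffs_def c_def funpow_swap1 del: of_nat_Suc)
    ultimately show ?thesis
      by (simp add: inner_flow flow_comm c_def)
  qed
  then show ?thesis
    unfolding has_vector_derivative_def
    by (subst has_derivative_componentwise_within)
       (auto simp: has_field_derivative_def mult.commute[of _ "_ \<bullet> _"] intro: has_derivative_at_withinI)
qed

end

subsection \<open>Integration by parts in the Sobolev space\<close>

lemma W11_deriv_continuous:
  assumes "W11_deriv T x v"
  shows "continuous_on {0..T} x"
proof -
  have "continuous_on {0..T} (\<lambda>t. x 0 + integral {0..t} v)"
    by (intro continuous_on_add continuous_on_const indefinite_integral_continuous_1)
      (use assms in \<open>simp add: W11_deriv_def absolutely_integrable_on_def\<close>)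
  moreover have "continuous_on {0..T} x \<longleftrightarrow> continuous_on {0..T} (\<lambda>t. x 0 + integral {0..t} v)"
    using assms unfolding W11_deriv_def by (intro continuous_on_cong refl) blast
  ultimately show ?thesis by simp
qed

lemma W11_deriv_diff:
  assumes "W11_deriv T x v" "0 \<le> a" "a \<le> b" "b \<le> T"
  shows "(v has_integral (x b - x a)) {a..b}"
proof -
  have v: "v integrable_on {0..T}" and x: "\<And>t. t \<in> {0..T} \<Longrightarrow> x t = x 0 + integral {0..t} v"
    using assms unfolding W11_deriv_def absolutely_integrable_on_def by blast+
  have i: "v integrable_on {0..b}" by (rule integrable_on_subinterval[OF v]) (use assms in auto)
  have "integral {0..a} v + integral {a..b} v = integral {0..b} v"
    by (rule Henstock_Kurzweil_Integration.integral_combine[OF _ _ i]) (use assms in auto)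
  moreover have "x a = x 0 + integral {0..a} v" "x b = x 0 + integral {0..b} v"
    by (rule x; use assms in simp)+
  ultimately have "x b - x a = integral {a..b} v" by (metis add_diff_cancel_left add_diff_cancel_left')
  then show ?thesis
    using integrable_integral[OF integrable_on_subinterval[OF v], of a b] assms by auto
qed

text \<open>The difference quotient is bounded by a multiple of the increment of \<open>M\<close>,
  which tends to 0 by continuity. In the application \<open>M\<close> is an indefinite integral of
  an integrable function and may fail to be differentiable at some points.\<close>

lemma has_vector_derivative_zero_if_continuous_modulus:
  fixes h :: "real \<Rightarrow> 'a::real_normed_vector" and M :: "real \<Rightarrow> real"
  assumes "\<And>s t. s \<in> S \<Longrightarrow> t \<in> S \<Longrightarrow> t \<le> s \<Longrightarrow> norm (h s - h t) \<le> K * (s - t) * (M s - M t)"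
    and "continuous_on S M" "t \<in> S"
  shows "(h has_vector_derivative 0) (at t within S)"
proof -
  have b: "norm (h s - h t) / \<bar>s - t\<bar> \<le> \<bar>K\<bar> * \<bar>M s - M t\<bar>" if "s \<in> S" "s \<noteq> t" for s
  proof -
    have "norm (h s - h t) \<le> \<bar>K * (s - t) * (M s - M t)\<bar>"
    proof (cases "t \<le> s")
      case True
      then show ?thesis using assms(1)[OF that(1) assms(3)] by linarith
    next
      case False
      then show ?thesis
        using assms(1)[OF assms(3) that(1)] by (simp add: norm_minus_commute algebra_simps)
    qed
    then have "norm (h s - h t) \<le> (\<bar>K\<bar> * \<bar>M s - M t\<bar>) * \<bar>s - t\<bar>" by (simp add: abs_mult mult_ac)
    then show ?thesis using that by (simp add: pos_divide_le_eq)
  qed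
  have "((\<lambda>s. \<bar>K\<bar> * \<bar>M s - M t\<bar>) \<longlongrightarrow> \<bar>K\<bar> * \<bar>M t - M t\<bar>) (at t within S)"
    using assms(2,3) unfolding continuous_on
    by (intro tendsto_mult tendsto_const tendsto_rabs tendsto_diff) simp
  then have lim: "((\<lambda>s. \<bar>K\<bar> * \<bar>M s - M t\<bar>) \<longlongrightarrow> 0) (at t within S)" by simp
  have "\<forall>\<^sub>F s in at t within S. norm (norm (h s - h t) / \<bar>s - t\<bar>) \<le> \<bar>K\<bar> * \<bar>M s - M t\<bar>"
    unfolding eventually_at_filter by (rule always_eventually) (simp add: b)
  then have "((\<lambda>s. norm (h s - h t) / \<bar>s - t\<bar>) \<longlongrightarrow> 0) (at t within S)"
    by (rule Lim_null_comparison[OF _ lim])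
  then show ?thesis
    unfolding has_vector_derivative_def has_derivative_iff_norm by simp
qed

text \<open>The product rule cannot be applied pointwise, since \<open>l\<close> has a derivative
  only almost everywhere. Instead, the defect \<open>h\<close> between the integral of
  \<open>g\<close> and the product has increments of order \<open>s - t\<close> times the mass of
  \<open>dl\<close> on \<open>{t..s}\<close>. So its derivative is 0 at every point, and
  \<open>h\<close> is constant.\<close>

lemma W11_deriv_inner_has_integral:
  fixes l :: "real \<Rightarrow> real^'n"
  assumes W: "W11_deriv T l dl"
    and C1: "\<And>t. t \<in> {0..T} \<Longrightarrow> (\<xi> has_vector_derivative \<xi>' t) (at t within {0..T})"
    and c': "continuous_on {0..T} \<xi>'"
    and ab: "0 \<le> a" "a \<le> b" "b \<le> T"
  shows "((\<lambda>t. dl t \<bullet> \<xi> t + l t \<bullet> \<xi>' t) has_integral (l b \<bullet> \<xi> b - l a \<bullet> \<xi> a)) {a..b}"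
proof -
  define g where "g t = dl t \<bullet> \<xi> t + l t \<bullet> \<xi>' t" for t
  define M where "M t = integral {0..t} (\<lambda>s. norm (dl s))" for t
  have c: "continuous_on {0..T} \<xi>"
    unfolding continuous_on_eq_continuous_within by (blast intro: has_vector_derivative_continuous C1)
  have cl: "continuous_on {0..T} l" by (rule W11_deriv_continuous[OF W])
  have dl: "dl absolutely_integrable_on {0..T}" using W unfolding W11_deriv_def by blast
  then have ndl: "(\<lambda>s. norm (dl s)) integrable_on {0..T}" by (simp add: absolutely_integrable_on_def)
  have cM: "continuous_on {0..T} M"
    unfolding M_def by (rule indefinite_integral_continuous_1[OF ndl])
  have "(\<lambda>t. \<xi> t \<bullet> dl t) absolutely_integrable_on {0..T}"
    by (rule absolutely_integrable_bounded_measurable_product[OF _ _ _ _ dl])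
      (auto intro!: continuous_imp_measurable_on_sets_lebesgue c compact_imp_bounded compact_continuous_image
        simp: bilinear_conv_bounded_bilinear bounded_bilinear_inner)
  then have "(\<lambda>t. dl t \<bullet> \<xi> t) integrable_on {0..T}"
    by (simp add: absolutely_integrable_on_def inner_commute)
  then have g: "g integrable_on {0..T}"
    unfolding g_def by (rule integrable_add) (intro integrable_continuous_real continuous_intros cl c')
  obtain K where K: "\<And>t. t \<in> {0..T} \<Longrightarrow> norm (\<xi>' t) \<le> K" and K0: "0 < K"
    using compact_imp_bounded[OF compact_continuous_image[OF c' compact_Icc]]
    unfolding bounded_pos by blast
  define h where "h t = integral {0..t} g - l t \<bullet> \<xi> t" for t
  have step: "norm (h s - h t) \<le> (2 * K) * (s - t) * (M s - M t)"
    if s: "s \<in> {0..T}" and t: "t \<in> {0..T}" and ts: "t \<le> s" for s t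
  proof -
    have sub: "{t..s} \<subseteq> {0..T}" using s t by auto
    have M: "((\<lambda>s. norm (dl s)) has_integral (M s - M t)) {t..s}"
    proof -
      have "integral {0..t} (\<lambda>s. norm (dl s)) + integral {t..s} (\<lambda>s. norm (dl s)) = M s"
        unfolding M_def
        by (rule Henstock_Kurzweil_Integration.integral_combine)
          (use t ts s in \<open>auto intro: integrable_on_subinterval[OF ndl]\<close>)
      moreover have "(\<lambda>s. norm (dl s)) integrable_on {t..s}"
        by (rule integrable_on_subinterval[OF ndl sub])
      ultimately show ?thesis unfolding M_def by (simp add: has_integral_iff)
    qed
    have gi: "(g has_integral (integral {0..s} g - integral {0..t} g)) {t..s}"
    proof -
      have "integral {0..t} g + integral {t..s} g = integral {0..s} g"
        by (rule Henstock_Kurzweil_Integration.integral_combine)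
          (use t ts s in \<open>auto intro: integrable_on_subinterval[OF g]\<close>)
      moreover have "g integrable_on {t..s}"
        by (rule integrable_on_subinterval[OF g sub])
      ultimately show ?thesis by (simp add: has_integral_iff)
    qed
    have xi: "(\<xi>' has_integral (\<xi> s - \<xi> t)) {t..s}"
      by (rule fundamental_theorem_of_calculus[OF ts])
        (use sub in \<open>auto intro: has_vector_derivative_within_subset[OF C1]\<close>)
    have lst: "(dl has_integral (l s - l t)) {t..s}"
      by (rule W11_deriv_diff[OF W]) (use s t ts in auto)
    \<comment> \<open>Freezing \<xi> at the right end and \<open>l\<close> at the left end gives an
      integrand whose integral is exactly the increment of the product.\<close>
    have p: "((\<lambda>r. dl r \<bullet> \<xi> s + l t \<bullet> \<xi>' r) has_integral ((l s - l t) \<bullet> \<xi> s + l t \<bullet> (\<xi> s - \<xi> t))) {t..s}"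
      using has_integral_add[OF has_integral_linear[OF lst bounded_linear_inner_left[of "\<xi> s"]]
          has_integral_linear[OF xi bounded_linear_inner_right[of "l t"]]]
      by (simp add: o_def)
    have d: "((\<lambda>r. g r - (dl r \<bullet> \<xi> s + l t \<bullet> \<xi>' r)) has_integral (h s - h t)) {t..s}"
      using has_integral_diff[OF gi p] by (simp add: h_def inner_diff algebra_simps)
    have bnd: "norm (g r - (dl r \<bullet> \<xi> s + l t \<bullet> \<xi>' r)) \<le> K * (s - t) * norm (dl r) + (M s - M t) * K"
      if r: "r \<in> {t..s}" for r
    proof -
      have "norm (\<xi> r - \<xi> s) \<le> K * norm (r - s)"
      proof (rule differentiable_bound[where S="{t..s}" and f'="\<lambda>r d. d *\<^sub>R \<xi>' r"])
        fix y assume y: "y \<in> {t..s}"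
        show "(\<xi> has_derivative (\<lambda>d. d *\<^sub>R \<xi>' y)) (at y within {t..s})"
          using has_vector_derivative_within_subset[OF C1 sub, of y] y sub
          by (auto simp: has_vector_derivative_def)
        have "norm (\<xi>' y) \<le> K" by (rule K) (use y sub in auto)
        then show "onorm (\<lambda>d. d *\<^sub>R \<xi>' y) \<le> K"
          by (intro onorm_le) (simp add: mult.commute[of K] mult_left_mono)
      qed (use r in auto)
      also have "\<dots> \<le> K * (s - t)" using r K0 by (intro mult_left_mono) auto
      finally have 1: "norm (\<xi> r - \<xi> s) \<le> K * (s - t)" .
      have 2: "norm (l r - l t) \<le> M s - M t"
      proof -
        have "(dl has_integral (l r - l t)) {t..r}"
          by (rule W11_deriv_diff[OF W]) (use s t r in auto)
        moreover have "(\<lambda>s. norm (dl s)) integrable_on {t..r}"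
          by (rule integrable_on_subinterval[OF ndl]) (use s t r in auto)
        ultimately have "norm (l r - l t) \<le> integral {t..r} (\<lambda>s. norm (dl s))"
          using integral_norm_bound_integral[of dl "{t..r}" "\<lambda>s. norm (dl s)"]
          by (auto simp: has_integral_iff)
        also have "\<dots> \<le> integral {t..s} (\<lambda>s. norm (dl s))"
          by (rule integral_subset_le) (use M r s t in \<open>auto simp: has_integral_iff intro: integrable_on_subinterval[OF ndl]\<close>)
        finally show ?thesis using M by (simp add: has_integral_iff)
      qed
      have "g r - (dl r \<bullet> \<xi> s + l t \<bullet> \<xi>' r) = dl r \<bullet> (\<xi> r - \<xi> s) + (l r - l t) \<bullet> \<xi>' r"
        by (simp add: g_def inner_diff algebra_simps)
      also have "norm \<dots> \<le> norm (dl r) * norm (\<xi> r - \<xi> s) + norm (l r - l t) * norm (\<xi>' r)"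
        using Cauchy_Schwarz_ineq2[of "dl r" "\<xi> r - \<xi> s"] Cauchy_Schwarz_ineq2[of "l r - l t" "\<xi>' r"]
        unfolding real_norm_def by linarith
      also have "\<dots> \<le> norm (dl r) * (K * (s - t)) + (M s - M t) * K"
      proof (intro add_mono mult_mono mult_left_mono)
        show "norm (\<xi>' r) \<le> K" by (rule K) (use r sub in auto)
      qed (use 1 2 order_trans[OF norm_ge_zero 2] in auto)
      finally show ?thesis by (simp add: mult_ac)
    qed
    have i: "((\<lambda>r. K * (s - t) * norm (dl r) + (M s - M t) * K) has_integral
        (K * (s - t) * (M s - M t) + (s - t) *\<^sub>R ((M s - M t) * K))) {t..s}"
      using has_integral_add[OF has_integral_mult_right[OF M, of "K * (s - t)"]
          has_integral_const_real[of "(M s - M t) * K" t s]] ts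
      by simp
    have "norm (h s - h t) \<le> K * (s - t) * (M s - M t) + (s - t) *\<^sub>R ((M s - M t) * K)"
      using integral_norm_bound_integral[OF has_integral_integrable[OF d] has_integral_integrable[OF i] bnd]
      unfolding integral_unique[OF d] integral_unique[OF i] .
    then show ?thesis by (simp add: algebra_simps)
  qed
  have "(h has_vector_derivative 0) (at t within {0..T})" if "t \<in> {0..T}" for t
    by (rule has_vector_derivative_zero_if_continuous_modulus[OF step cM that])
  then obtain k where k: "\<And>t. t \<in> {0..T} \<Longrightarrow> h t = k"
    using has_derivative_zero_constant[of "{0..T}" h] unfolding has_vector_derivative_def by auto
  have "integral {0..a} g + integral {a..b} g = integral {0..b} g"
    by (rule Henstock_Kurzweil_Integration.integral_combine)
      (use ab in \<open>auto intro: integrable_on_subinterval[OF g]\<close>)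
  then have "integral {a..b} g = l b \<bullet> \<xi> b - l a \<bullet> \<xi> a"
    using k[of a] k[of b] ab by (simp add: h_def)
  moreover have "g integrable_on {a..b}"
    by (rule integrable_on_subinterval[OF g]) (use ab in auto)
  ultimately show ?thesis unfolding g_def by (simp add: has_integral_iff)
qed

subsection \<open>Controllability\<close>

lemma matrix_vector_norm_bound:
  fixes M :: "real^'n^'m"
  obtains b where "0 < b" "\<And>x. norm (M *v x) \<le> b * norm x"
  using linear_bounded_pos[OF matrix_vector_mul_linear[of M]] by blast

text \<open>The powers of A are moved to the other factor. They become iterates of minus the
  transpose, with a sign, because the time derivatives of a costate produce these iterates.\<close>

lemma inner_funpow_matrix_mult:
  fixes A :: "real^'n^'n" and C :: "real^'m^'n"
  shows "p \<bullet> (((\<lambda>X. A ** X) ^^ k) C *v y) = (-1) ^ k * (((\<lambda>p. - (transpose A *v p)) ^^ k) p \<bullet> (C *v y))"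
proof (induction k arbitrary: p)
  case (Suc k)
  have "p \<bullet> (((\<lambda>X. A ** X) ^^ Suc k) C *v y) = p \<bullet> (A *v (((\<lambda>X. A ** X) ^^ k) C *v y))"
    by (simp add: matrix_vector_mul_assoc)
  also have "\<dots> = - ((- (transpose A *v p)) \<bullet> (((\<lambda>X. A ** X) ^^ k) C *v y))"
    by (simp add: dot_lmul_matrix transpose_matrix_vector)
  also have "\<dots> = (-1) ^ Suc k * (((\<lambda>p. - (transpose A *v p)) ^^ k) (- (transpose A *v p)) \<bullet> (C *v y))"
    unfolding Suc by simp
  finally show ?case by (simp only: funpow_Suc_right o_apply)
qed simp

text \<open>Duality of controllability and observability: the hypothesis makes p orthogonal to all
  columns in Kalman's condition, and these span the space, so p is orthogonal to itself.\<close>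

lemma controllable_imp_observable:
  fixes A :: "real^'n^'n" and C :: "real^'m^'n"
  assumes "controllable A C"
    and "\<And>k. transpose C *v ((\<lambda>p. - (transpose A *v p)) ^^ k) p = 0"
  shows "p = 0"
proof -
  define S where "S = (\<Union>k<CARD('n). columns (((\<lambda>X. A ** X) ^^ k) C))"
  have "orthogonal p y" if "y \<in> S" for y
  proof -
    obtain k i where y: "y = column i (((\<lambda>X. A ** X) ^^ k) C)"
      using \<open>y \<in> S\<close> by (auto simp: S_def columns_def)
    have "p \<bullet> (((\<lambda>X. A ** X) ^^ k) C *v axis i 1) = 0"
      unfolding inner_funpow_matrix_mult
      by (simp flip: dot_lmul_matrix add: assms(2)[unfolded transpose_matrix_vector] transpose_matrix_vector)
    then show ?thesis by (simp add: orthogonal_def y matrix_vector_mult_basis)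
  qed
  moreover have "span S = UNIV"
    using assms(1) by (intro dim_eq_full[THEN iffD1]) (simp add: controllable_def S_def)
  ultimately have "orthogonal p p" using orthogonal_to_span[of p S p] by auto
  then show ?thesis by (simp add: orthogonal_def)
qed

text \<open>The controls are \<open>C\<^sup>T q\<close> with \<open>q' = - A\<^sup>T q\<close>. Along them \<open>(\<xi> \<bullet> q)' = |C\<^sup>T q|\<^sup>2\<close> for
  \<open>\<xi> 0 = 0\<close>, so the linear map from \<open>q 0\<close> to \<open>\<xi> d\<close> is injective by observability, hence onto.\<close>

lemma steering:
  fixes A :: "real^'n^'n" and C :: "real^'m^'n"
  assumes ctrl: "controllable A C" and d: "0 < d"
  obtains K where "0 < K"
    "\<And>a b. \<exists>\<xi> v. \<xi> 0 = a \<and> \<xi> d = b \<and> continuous_on UNIV v \<and>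
        (\<forall>t s. (\<xi> has_vector_derivative A *v \<xi> t + C *v v t) (at t within s)) \<and>
        (\<forall>t\<in>{0..d}. norm (\<xi> t) \<le> K * (norm a + norm b) \<and> norm (v t) \<le> K * (norm a + norm b))"
proof -
  define f :: "(real^'n) \<times> (real^'n) \<Rightarrow> (real^'n) \<times> (real^'n)" where
    "f = (\<lambda>p. (A *v fst p + C *v (transpose C *v snd p), - (transpose A *v snd p)))"
  have lf: "linear f"
    by (rule linearI) (auto simp: f_def matrix_vector_right_distrib matrix_vector_mult_scaleR algebra_simps simp del: transpose_matrix_vector)
  obtain B where B: "0 < B" "\<And>x. norm (f x) \<le> B * norm x"
    using linear_bounded_pos[OF lf] by blast
  note fl = lf B(2) less_imp_le[OF B(1)]
  define X Y where "X t p = fst (flow f t p)" and "Y t p = snd (flow f t p)" for t p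
  have flow_deriv: "((\<lambda>t. flow f t p) has_vector_derivative f (flow f t p)) (at t within s)" for p t s
    by (rule flow_has_vector_derivative[OF fl])
  have X': "((\<lambda>t. X t p) has_vector_derivative A *v X t p + C *v (transpose C *v Y t p)) (at t within s)"
    and Y': "((\<lambda>t. Y t p) has_vector_derivative - (transpose A *v Y t p)) (at t within s)" for p t s
    using bounded_linear.has_vector_derivative[OF bounded_linear_fst flow_deriv[of p t s]]
      bounded_linear.has_vector_derivative[OF bounded_linear_snd flow_deriv[of p t s]]
    by (simp_all add: X_def Y_def f_def)
  have X0: "X 0 p = fst p" "Y 0 p = snd p" for p
    by (simp_all add: X_def Y_def flow_0[OF fl])
  have lX: "linear (\<lambda>q. X d (0, q))"
    unfolding X_def
    using linear_compose[OF linear_compose[OF _ flow_linear[OF fl, of d]] linear_fst, of "\<lambda>q. (0, q)"]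
    by (simp add: o_def linear_iff)
  have inj: "q = 0" if Xd: "X d (0, q) = 0" for q
  proof -
    define x y where "x t = X t (0, q)" and "y t = Y t (0, q)" for t
    have h': "((\<lambda>t. x t \<bullet> y t) has_vector_derivative (norm (transpose C *v y t))\<^sup>2) (at t within s)" for t s
    proof -
      have "((\<lambda>t. x t \<bullet> y t) has_vector_derivative
          x t \<bullet> (- (transpose A *v y t)) + (A *v x t + C *v (transpose C *v y t)) \<bullet> y t) (at t within s)"
        unfolding x_def y_def
        by (rule bounded_bilinear.has_vector_derivative[OF bounded_bilinear_inner X' Y'])
      moreover have "x t \<bullet> (- (transpose A *v y t)) + (A *v x t + C *v (transpose C *v y t)) \<bullet> y t
          = (norm (transpose C *v y t))\<^sup>2"
        by (simp add: inner_add_left inner_commute[of "A *v _"] inner_commute[of "C *v _"] inner_commute[of "x t"]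
            dot_lmul_matrix transpose_matrix_vector power2_norm_eq_inner flip: dot_lmul_matrix)
      ultimately show ?thesis by simp
    qed
    \<comment> \<open>The pairing is nondecreasing and vanishes at both ends, hence throughout; its
      derivative, the squared norm of the control, then vanishes as well.\<close>
    have hz: "x t \<bullet> y t = 0" if t: "t \<in> {0..d}" for t
    proof -
      have mono: "x s \<bullet> y s \<le> x r \<bullet> y r" if "s \<le> r" for s r
        by (rule DERIV_nonneg_imp_nondecreasing[OF that])
          (use h'[of _ UNIV] in \<open>auto simp: has_real_derivative_iff_has_vector_derivative
            simp del: transpose_matrix_vector intro!: exI\<close>)
      have "x 0 \<bullet> y 0 = 0" "x d \<bullet> y d = 0" by (simp_all add: x_def X0 Xd)
      then show ?thesis using mono[of 0 t] mono[of t d] t by auto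
    qed
    \<comment> \<open>Derivatives within the closed interval are used so that the conclusion also
      covers its end points; it is needed at time 0.\<close>
    have uniq: "w = 0" if "(g has_vector_derivative w) (at t within {0..d})" "t \<in> {0..d}"
        "\<And>s. s \<in> {0..d} \<Longrightarrow> g s = 0" for g :: "real \<Rightarrow> 'b::euclidean_space" and w t
    proof -
      have "((\<lambda>_. 0) has_vector_derivative w) (at t within {0..d})"
        by (rule has_vector_derivative_transform[OF that(2) _ that(1)]) (simp add: that(3))
      then show ?thesis
        using vector_derivative_unique_within_closed_interval[of 0 d t "\<lambda>_. 0" w 0] d that(2) by simp
    qed
    define g where "g = (\<lambda>p. - (transpose A *v p))"
    have gl: "bounded_linear (\<lambda>p. transpose C *v (g ^^ k) p)" for k
    proof -
      have "linear g" by (rule linearI) (auto simp: g_def matrix_vector_right_distrib matrix_vector_mult_scaleR simp del: transpose_matrix_vector)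
      then have "linear (g ^^ k)"
        by (induction k) (auto simp: linear_id[unfolded id_def] id_def intro: linear_compose)
      then have "linear ((*v) (transpose C) \<circ> (g ^^ k))" by (intro linear_compose matrix_vector_mul_linear)
      then show ?thesis by (simp add: o_def linear_conv_bounded_linear)
    qed
    \<comment> \<open>Each differentiation in time of the identity for k replaces \<open>y t\<close>
      by \<open>g (y t)\<close> and gives the identity for k + 1.\<close>
    have "transpose C *v (g ^^ k) (y t) = 0" if "t \<in> {0..d}" for k t
      using that
    proof (induction k arbitrary: t)
      case 0
      have "(norm (transpose C *v y t))\<^sup>2 = (0::real)"
        by (rule uniq[OF h' 0]) (rule hz)
      then show ?case by simp
    next
      case (Suc k)
      have "((\<lambda>t. transpose C *v (g ^^ k) (y t)) has_vector_derivative transpose C *v (g ^^ k) (g (y t)))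
          (at t within {0..d})"
        unfolding y_def g_def
        by (rule bounded_linear.has_vector_derivative[OF gl[unfolded g_def] Y'])
      from uniq[OF this Suc.prems Suc.IH] show ?case by (simp add: funpow_swap1)
    qed
    from this[of 0] d have "y 0 = 0"
      by (intro controllable_imp_observable[OF ctrl]) (simp add: g_def)
    then show ?thesis by (simp add: y_def X0)
  qed
  have "inj (\<lambda>q. X d (0, q))"
    using inj by (simp add: linear_injective_0[OF lX])
  then have "surj (\<lambda>q. X d (0, q))" by (rule linear_injective_imp_surjective[OF lX]) simp
  then obtain g where g: "linear g" "(\<lambda>q. X d (0, q)) \<circ> g = id"
    using linear_surjective_right_inverse[OF lX] by blast
  have gX: "X d (0, g z) = z" for z using g(2) by (simp add: fun_eq_iff)
  obtain G where G: "0 < G" "\<And>x. norm (g x) \<le> G * norm x"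
    using linear_bounded_pos[OF g(1)] by blast
  obtain c where c: "0 < c" "\<And>x. norm (transpose C *v x) \<le> c * norm x"
    using matrix_vector_norm_bound[of "transpose C"] by blast
  define E where "E = exp (B * d)"
  have E1: "1 \<le> E" using B d by (simp add: E_def)
  \<comment> \<open>\<open>E\<close> bounds the flow on \<open>{0..d}\<close>,
    \<open>1 + G * E\<close> bounds the initial pair \<open>(a, q)\<close>, and \<open>1 + c\<close>
    covers both the state (factor 1) and the control (factor \<open>c\<close>).\<close>
  define K where "K = (1 + c) * (E * (1 + G * E))"
  show ?thesis
  proof (rule that)
    show "0 < K" using c E1 G by (simp add: K_def add_pos_pos)
    fix a b :: "real^'n"
    \<comment> \<open>By superposition, q only has to make up for the gap between the target and the
      point that a reaches without control.\<close>
    define q where "q = g (b - X d (a, 0))"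
    have le: "norm (flow f t p) \<le> E * norm p" if "t \<in> {0..d}" for t p
    proof -
      have "exp (B * \<bar>t\<bar>) \<le> E" using that B by (simp add: E_def)
      then show ?thesis
        using norm_flow_le[OF fl, of t p] by (meson mult_right_mono norm_ge_zero order_trans)
    qed
    have "X d (a, q) = X d (a, 0) + X d (0, q)"
      using linear_add[OF flow_linear[OF fl], of d "(a, 0)" "(0, q)"] by (simp add: X_def)
    then have Xd: "X d (a, q) = b" by (simp add: q_def gX)
    have n1: "norm (X d (a, 0)) \<le> E * norm a"
      using le[of d "(a, 0)"] d norm_fst_le[of "fst (flow f d (a, 0))" "snd (flow f d (a, 0))"] by (simp add: X_def norm_Pair) 
    have "norm q \<le> G * norm (b - X d (a, 0))" by (simp add: q_def G)
    also have "\<dots> \<le> G * (norm b + E * norm a)"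
      using n1 norm_triangle_ineq4[of b "X d (a, 0)"] G by (intro mult_left_mono) auto
    also have "\<dots> \<le> G * (E * norm b + E * norm a)"
      using G E1 mult_right_mono[OF E1, of "norm b"] by (intro mult_left_mono) auto
    finally have "norm q \<le> G * E * (norm a + norm b)" by (simp add: algebra_simps)
    moreover have "norm (a, q) \<le> norm a + norm q" by (rule norm_Pair_le)
    ultimately have "norm (a, q) \<le> (1 + G * E) * (norm a + norm b)"
      by (simp add: algebra_simps) (use norm_ge_zero[of b] in linarith)
    then have n: "norm (flow f t (a, q)) \<le> E * ((1 + G * E) * (norm a + norm b))" if "t \<in> {0..d}" for t
      using le[OF that, of "(a, q)"] E1 by (meson mult_left_mono order_trans zero_le_one)
    have bX: "norm (X t (a, q)) \<le> K * (norm a + norm b)" if "t \<in> {0..d}" for t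
    proof -
      have "norm (X t (a, q)) \<le> 1 * (E * ((1 + G * E) * (norm a + norm b)))"
        using norm_fst_le[of "fst (flow f t (a, q))" "snd (flow f t (a, q))"] n[OF that] by (simp add: X_def)
      also have "\<dots> \<le> (1 + c) * (E * ((1 + G * E) * (norm a + norm b)))"
        using c E1 G by (intro mult_right_mono) auto
      finally show ?thesis by (simp add: K_def mult.assoc)
    qed
    have bY: "norm (transpose C *v Y t (a, q)) \<le> K * (norm a + norm b)" if "t \<in> {0..d}" for t
    proof -
      have "norm (transpose C *v Y t (a, q)) \<le> c * norm (Y t (a, q))" by (rule c)
      also have "\<dots> \<le> c * (E * ((1 + G * E) * (norm a + norm b)))"
        using norm_snd_le[of "snd (flow f t (a, q))" "fst (flow f t (a, q))"] n[OF that] c by (intro mult_left_mono) (auto simp: Y_def)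
      also have "\<dots> \<le> (1 + c) * (E * ((1 + G * E) * (norm a + norm b)))"
        using c E1 G by (intro mult_right_mono) auto
      finally show ?thesis by (simp add: K_def mult.assoc)
    qed
    have cY: "continuous_on UNIV (\<lambda>t. transpose C *v Y t (a, q))"
    proof -
      have "continuous_on UNIV (\<lambda>t. Y t (a, q))"
        unfolding continuous_on_eq_continuous_within by (blast intro: has_vector_derivative_continuous Y')
      then show ?thesis by (intro matrix_vector_mult_linear_continuous_on[THEN continuous_on_compose2]) auto
    qed
    show "\<exists>\<xi> v. \<xi> 0 = a \<and> \<xi> d = b \<and> continuous_on UNIV v \<and>
        (\<forall>t s. (\<xi> has_vector_derivative A *v \<xi> t + C *v v t) (at t within s)) \<and>
        (\<forall>t\<in>{0..d}. norm (\<xi> t) \<le> K * (norm a + norm b) \<and> norm (v t) \<le> K * (norm a + norm b))"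
      by (rule exI[of _ "\<lambda>t. X t (a, q)"], rule exI[of _ "\<lambda>t. transpose C *v Y t (a, q)"])
        (use X' Xd cY bX bY in \<open>simp add: X0\<close>)
  qed
qed

subsection \<open>Concatenation of trajectories\<close>

lemma AE_lebesgue_on_iff_negligible:
  assumes "S \<in> sets lebesgue"
  shows "(AE t in lebesgue_on S. P t) \<longleftrightarrow> (\<exists>N. negligible N \<and> (\<forall>t\<in>S - N. P t))"
proof -
  have "(AE t in lebesgue_on S. P t) \<longleftrightarrow> (AE t in lebesgue. t \<in> S \<longrightarrow> P t)"
    using assms by (subst AE_restrict_space_iff) simp_all
  also have "\<dots> \<longleftrightarrow> (\<exists>N. negligible N \<and> {t. \<not> (t \<in> S \<longrightarrow> P t)} \<subseteq> N)"
    by (rule eventually_ae_filter_negligible)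
  finally show ?thesis by (auto simp: subset_iff)
qed

lemma AE_lebesgue_onE:
  fixes a b :: real
  assumes "AE t in lebesgue_on {a..b}. P t"
  obtains N where "negligible N" "\<And>t. t \<in> {a..b} \<Longrightarrow> t \<notin> N \<Longrightarrow> P t"
  using assms by (subst (asm) AE_lebesgue_on_iff_negligible) auto

lemma AE_lebesgue_onI:
  fixes a b :: real
  assumes "negligible N" "\<And>t. t \<in> {a..b} \<Longrightarrow> t \<notin> N \<Longrightarrow> P t"
  shows "AE t in lebesgue_on {a..b}. P t"
  using assms by (subst AE_lebesgue_on_iff_negligible) auto

definition glue :: "real \<Rightarrow> (real \<Rightarrow> 'a) \<Rightarrow> (real \<Rightarrow> 'a) \<Rightarrow> real \<Rightarrow> 'a" where
  "glue s f g t = (if t < s then f t else g (t - s))"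

lemma glue_left: "t < s \<Longrightarrow> glue s f g t = f t"
  and glue_right: "s \<le> t \<Longrightarrow> glue s f g t = g (t - s)"
  by (simp_all add: glue_def)

lemma has_integral_glue:
  fixes f g :: "real \<Rightarrow> 'a::banach"
  assumes f: "(f has_integral i) {0..s}" and g: "(g has_integral j) {0..r}" and sr: "0 \<le> s" "0 \<le> r"
  shows "(glue s f g has_integral i + j) {0..s + r}"
proof (rule has_integral_combine[where c = s])
  show "(glue s f g has_integral i) {0..s}"
    by (rule has_integral_spike[OF _ _ f, of "{s}"]) (auto simp: glue_def)
  have "((\<lambda>t. g (t + - s)) has_integral j) {0 - - s..r - - s}"
    by (rule has_integral_shift_real_ivl[OF g])
  then have "((\<lambda>t. g (t + - s)) has_integral j) {s..s + r}" by (simp add: add.commute)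
  then show "(glue s f g has_integral j) {s..s + r}"
    by (rule has_integral_eq[rotated]) (simp add: glue_def)
qed (use sr in auto)

lemma glue_compose: "(\<lambda>t. h (glue s f g t)) = glue s (\<lambda>t. h (f t)) (\<lambda>t. h (g t))"
  by (auto simp: glue_def)

lemma glue_compose2:
  "(\<lambda>t. h (glue s f g t) (glue s f' g' t)) = glue s (\<lambda>t. h (f t) (f' t)) (\<lambda>t. h (g t) (g' t))"
  by (auto simp: glue_def)

lemma absolutely_integrable_glue:
  fixes f g :: "real \<Rightarrow> 'a::euclidean_space"
  assumes "f absolutely_integrable_on {0..s}" "g absolutely_integrable_on {0..r}" "0 \<le> s" "0 \<le> r"
  shows "glue s f g absolutely_integrable_on {0..s + r}"
  using assms unfolding absolutely_integrable_on_def glue_compose[of norm]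
  by (meson has_integral_glue integrable_on_def)

text \<open>Three functions are glued at once because the control equation relates velocity, state
  and control at the same time.\<close>

lemma AE_glue:
  assumes "AE t in lebesgue_on {0..s}. P (f t) (f' t) (f'' t)"
    "AE t in lebesgue_on {0..r}. P (g t) (g' t) (g'' t)"
  shows "AE t in lebesgue_on {0..s + r}. P (glue s f g t) (glue s f' g' t) (glue s f'' g'' t)"
proof -
  obtain N where N: "negligible N" "\<And>t. t \<in> {0..s} \<Longrightarrow> t \<notin> N \<Longrightarrow> P (f t) (f' t) (f'' t)"
    using AE_lebesgue_onE[OF assms(1)] by blast
  obtain N' where N': "negligible N'" "\<And>t. t \<in> {0..r} \<Longrightarrow> t \<notin> N' \<Longrightarrow> P (g t) (g' t) (g'' t)"
    using AE_lebesgue_onE[OF assms(2)] by blast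
  show ?thesis
  proof (rule AE_lebesgue_onI)
    show "negligible (N \<union> (+) s ` N')" using N N' by (intro negligible_Un negligible_translation)
    fix t assume t: "t \<in> {0..s + r}" "t \<notin> N \<union> (+) s ` N'"
    show "P (glue s f g t) (glue s f' g' t) (glue s f'' g'' t)"
    proof (cases "t < s")
      case True
      then show ?thesis using t N(2)[of t] by (simp add: glue_left)
    next
      case False
      have "t - s \<notin> N'"
      proof
        assume "t - s \<in> N'"
        then have "s + (t - s) \<in> (+) s ` N'" by blast
        then show False using t by simp
      qed
      then show ?thesis using t False N'(2)[of "t - s"] by (simp add: glue_right)
    qed
  qed
qed

lemma W11_deriv_glue:
  assumes x: "W11_deriv s x v" and y: "W11_deriv r y w" and sr: "0 \<le> s" "0 \<le> r" and xy: "x s = y 0"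
  shows "W11_deriv (s + r) (glue s x y) (glue s v w)"
proof -
  have g0: "glue s x y 0 = x 0" using sr xy by (auto simp: glue_def)
  have "glue s x y t - x 0 = integral {0..t} (glue s v w)" if t: "t \<in> {0..s + r}" for t
  proof (cases "t < s")
    case True
    have "(v has_integral (x t - x 0)) {0..t}"
      by (rule W11_deriv_diff[OF x]) (use t True in auto)
    then have "(glue s v w has_integral (x t - x 0)) {0..t}"
      by (rule has_integral_eq[rotated]) (use True in \<open>simp add: glue_left\<close>)
    then show ?thesis using True by (simp add: glue_left integral_unique)
  next
    case False
    have v: "(v has_integral (x s - x 0)) {0..s}"
      by (rule W11_deriv_diff[OF x]) (use sr in auto)
    have w: "(w has_integral (y (t - s) - y 0)) {0..t - s}"
      by (rule W11_deriv_diff[OF y]) (use False t in auto)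
    have "(glue s v w has_integral (x s - x 0 + (y (t - s) - y 0))) {0..s + (t - s)}"
      by (rule has_integral_glue[OF v w]) (use False sr in auto)
    then show ?thesis using False xy by (simp add: glue_right integral_unique)
  qed
  then have "\<forall>t\<in>{0..s + r}. glue s x y t = glue s x y 0 + integral {0..t} (glue s v w)"
    unfolding g0 by (metis add.commute diff_add_cancel)
  moreover have "glue s v w absolutely_integrable_on {0..s + r}"
    by (rule absolutely_integrable_glue) (use x y sr in \<open>unfold W11_deriv_def, blast+\<close>)
  ultimately show ?thesis unfolding W11_deriv_def by blast
qed

lemma ocp_admissible_glue:
  assumes "ocp_admissible A C U {b} a s x u" "ocp_admissible A C U \<Phi> b r y w" "0 \<le> s" "0 \<le> r"
  shows "ocp_admissible A C U \<Phi> a (s + r) (glue s x y) (glue s u w)"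
proof -
  have xy: "x s = y 0" and e: "x 0 = a" "y r \<in> \<Phi>"
    and u: "u absolutely_integrable_on {0..s}" "w absolutely_integrable_on {0..r}"
    and U: "AE t in lebesgue_on {0..s}. u t \<in> U" "AE t in lebesgue_on {0..r}. w t \<in> U"
    using assms by (auto simp: ocp_admissible_def L1_control_def)
  obtain v where v: "W11_deriv s x v" "AE t in lebesgue_on {0..s}. v t = A *v x t + C *v u t"
    using assms(1) by (auto simp: ocp_admissible_def trajectory_def)
  obtain v' where v': "W11_deriv r y v'" "AE t in lebesgue_on {0..r}. v' t = A *v y t + C *v w t"
    using assms(2) by (auto simp: ocp_admissible_def trajectory_def)
  have "trajectory A C (s + r) (glue s x y) (glue s u w)"
    unfolding trajectory_def
    by (rule exI[of _ "glue s v v'"])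
      (use W11_deriv_glue[OF v(1) v'(1) assms(3,4) xy]
        AE_glue[where P = "\<lambda>v x u. v = A *v x + C *v u", OF v(2) v'(2)] in simp)
  moreover have "L1_control U (s + r) (glue s u w)"
    unfolding L1_control_def
    using absolutely_integrable_glue[OF u assms(3,4)] AE_glue[where P = "\<lambda>u _ _. u \<in> U", OF U] by simp
  ultimately show ?thesis
    using assms(3,4) e xy by (auto simp: ocp_admissible_def glue_def)
qed

lemma ocp_admissible_smooth:
  fixes A :: "real^'n^'n" and C :: "real^'m^'n"
  assumes "0 \<le> T" "continuous_on UNIV v"
    and "\<And>t s. (\<xi> has_vector_derivative A *v \<xi> t + C *v v t) (at t within s)"
    and "\<And>t. t \<in> {0..T} \<Longrightarrow> v t \<in> U" and "\<xi> T \<in> \<Phi>"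
  shows "ocp_admissible A C U \<Phi> (\<xi> 0) T \<xi> v"
proof -
  have c: "continuous_on {0..T} \<xi>"
    unfolding continuous_on_eq_continuous_within by (blast intro: has_vector_derivative_continuous assms(3))
  have cv: "continuous_on {0..T} v" using assms(2) by (rule continuous_on_subset) simp
  have cd: "continuous_on {0..T} (\<lambda>t. A *v \<xi> t + C *v v t)"
    by (intro continuous_on_add matrix_vector_mult_linear_continuous_on[THEN continuous_on_compose2] c cv) auto
  have "\<xi> t - \<xi> 0 = integral {0..t} (\<lambda>t. A *v \<xi> t + C *v v t)" if "t \<in> {0..T}" for t
    using fundamental_theorem_of_calculus[of 0 t \<xi> "\<lambda>t. A *v \<xi> t + C *v v t"] assms(3) that
    by (simp add: integral_unique)
  then have "W11_deriv T \<xi> (\<lambda>t. A *v \<xi> t + C *v v t)"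
    unfolding W11_deriv_def using absolutely_integrable_continuous_real[OF cd]
    by (metis add.commute diff_add_cancel)
  then have "trajectory A C T \<xi> v" unfolding trajectory_def by auto
  moreover have "L1_control U T v"
    unfolding L1_control_def using absolutely_integrable_continuous_real[OF cv] assms(4)
    by (auto intro: AE_I2)
  ultimately show ?thesis using assms by (simp add: ocp_admissible_def)
qed

subsection \<open>A priori bounds\<close>

lemma norm_has_integral_le_AE:
  fixes f :: "real \<Rightarrow> 'a::euclidean_space"
  assumes f: "(f has_integral i) {a..b}" and g: "(g has_integral j) {a..b}"
    and le: "AE t in lebesgue_on {a..b}. norm (f t) \<le> g t"
  shows "norm i \<le> j"
proof -
  obtain N where N: "negligible N" "\<And>t. t \<in> {a..b} \<Longrightarrow> t \<notin> N \<Longrightarrow> norm (f t) \<le> g t"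
    using AE_lebesgue_onE[OF le] by blast
  define f' g' where "f' t = (if t \<in> N then 0 else f t)" and "g' t = (if t \<in> N then 0 else g t)" for t
  have f': "(f' has_integral i) {a..b}" by (rule has_integral_spike[OF N(1) _ f]) (simp add: f'_def)
  have g': "(g' has_integral j) {a..b}" by (rule has_integral_spike[OF N(1) _ g]) (simp add: g'_def)
  have "norm (integral {a..b} f') \<le> integral {a..b} g'"
    by (rule integral_norm_bound_integral[OF has_integral_integrable[OF f'] has_integral_integrable[OF g']])
      (simp add: f'_def g'_def N(2))
  then show ?thesis unfolding integral_unique[OF f'] integral_unique[OF g'] .
qed

lemma norm_square_integrable_if_bounded:
  fixes f :: "real \<Rightarrow> 'a::euclidean_space"
  assumes f: "f absolutely_integrable_on {a..b}" and c: "AE t in lebesgue_on {a..b}. norm (f t) \<le> c"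
  shows "(\<lambda>t. (norm (f t))\<^sup>2) integrable_on {a..b}"
proof -
  have i: "integrable (lebesgue_on {a..b}) f" by (rule absolutely_integrable_imp_integrable[OF f]) simp
  have "integrable (lebesgue_on {a..b}) (\<lambda>t. (norm (f t))\<^sup>2)"
  proof (rule Bochner_Integration.integrable_bound)
    show "integrable (lebesgue_on {a..b}) (\<lambda>t. c * norm (f t))" using i by simp
    show "(\<lambda>t. (norm (f t))\<^sup>2) \<in> borel_measurable (lebesgue_on {a..b})"
      using borel_measurable_integrable[OF i] by measurable
    show "AE t in lebesgue_on {a..b}. norm ((norm (f t))\<^sup>2) \<le> norm (c * norm (f t))"
      using c
    proof eventually_elim
      case (elim t)
      then have "norm (f t) * norm (f t) \<le> \<bar>c\<bar> * norm (f t)" by (intro mult_right_mono) auto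
      then show ?case by (simp add: power2_eq_square abs_mult)
    qed
  qed
  then show ?thesis by (rule integrable_on_lebesgue_on) simp
qed

lemma absolutely_integrable_Pair:
  fixes f :: "real \<Rightarrow> 'a::euclidean_space" and g :: "real \<Rightarrow> 'b::euclidean_space"
  assumes "f absolutely_integrable_on S" "g absolutely_integrable_on S"
  shows "(\<lambda>t. (f t, g t)) absolutely_integrable_on S"
proof -
  have "linear (\<lambda>x::'a. (x, 0::'b))" "linear (\<lambda>x::'b. (0::'a, x))"
    by (auto intro!: linearI)
  then have "((\<lambda>x. (x, 0::'b)) \<circ> f) absolutely_integrable_on S" "((\<lambda>x. (0::'a, x)) \<circ> g) absolutely_integrable_on S"
    using assms by (auto intro!: absolutely_integrable_linear simp: linear_conv_bounded_linear)
  from set_integral_add(1)[OF this] show ?thesis by (simp add: o_def)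
qed

lemma stack_linear: "linear (\<lambda>p. V *v stack (fst p) (snd p))"
proof -
  have "linear (\<lambda>p. stack (fst p) (snd p))"
    by (rule linearI) (auto simp: stack_def vec_eq_iff split: sum.split)
  from linear_compose[OF this matrix_vector_mul_linear] show ?thesis by (simp add: o_def)
qed

lemma stack_norm_bound:
  obtains c where "0 < c" "\<And>x u. norm (V *v stack x u) \<le> c * (norm x + norm u)"
proof -
  obtain c where c: "0 < c" "\<And>p. norm (V *v stack (fst p) (snd p)) \<le> c * norm p"
    using linear_bounded_pos[OF stack_linear[of V]] by blast
  have "norm (V *v stack x u) \<le> c * (norm x + norm u)" for x u
    using order_trans[OF c(2)[of "(x, u)"] mult_left_mono[OF norm_Pair_le[of x u], of c]] c(1) by simp
  then show thesis using c(1) that by blast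
qed

text \<open>Integrability has to be secured because \<open>integral\<close> is 0 by default
  otherwise, which would spoil comparisons of cost. The control is merely integrable, but its values
  lie in a bounded set almost everywhere, so the square is dominated by a multiple of the
  norm.\<close>

lemma running_cost_integrable:
  assumes adm: "ocp_admissible A C U \<Phi> a T x u" and U: "bounded U"
  shows "(\<lambda>t. running_cost W (x t) (u t)) integrable_on {0..T}"
proof -
  obtain v where v: "W11_deriv T x v" using adm by (auto simp: ocp_admissible_def trajectory_def)
  have u: "u absolutely_integrable_on {0..T}" "AE t in lebesgue_on {0..T}. u t \<in> U"
    using adm by (auto simp: ocp_admissible_def L1_control_def)
  have cx: "continuous_on {0..T} x" by (rule W11_deriv_continuous[OF v])
  obtain X where X: "\<And>t. t \<in> {0..T} \<Longrightarrow> norm (x t) \<le> X"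
    using compact_imp_bounded[OF compact_continuous_image[OF cx compact_Icc]] unfolding bounded_iff by blast
  obtain M where M: "\<And>y. y \<in> U \<Longrightarrow> norm y \<le> M" using U by (auto simp: bounded_iff)
  obtain c where c: "0 < c" "\<And>x u. norm (psd_sqrt W *v stack x u) \<le> c * (norm x + norm u)"
    using stack_norm_bound[of "psd_sqrt W"] by blast
  have "((\<lambda>p. psd_sqrt W *v stack (fst p) (snd p)) \<circ> (\<lambda>t. (x t, u t))) absolutely_integrable_on {0..T}"
    by (intro absolutely_integrable_linear absolutely_integrable_Pair u
        absolutely_integrable_continuous_real[OF cx] linear_conv_bounded_linear[THEN iffD1] stack_linear)
  then have w: "(\<lambda>t. psd_sqrt W *v stack (x t) (u t)) absolutely_integrable_on {0..T}" by (simp add: o_def)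
  obtain N where N: "negligible N" "\<And>t. t \<in> {0..T} \<Longrightarrow> t \<notin> N \<Longrightarrow> u t \<in> U"
    using AE_lebesgue_onE[OF u(2)] by blast
  have "AE t in lebesgue_on {0..T}. norm (psd_sqrt W *v stack (x t) (u t)) \<le> c * (X + M)"
  proof (rule AE_lebesgue_onI[OF N(1)])
    fix t assume t: "t \<in> {0..T}" "t \<notin> N"
    show "norm (psd_sqrt W *v stack (x t) (u t)) \<le> c * (X + M)"
      by (rule order_trans[OF c(2)]) (use c(1) X[OF t(1)] M[OF N(2)[OF t]] in \<open>simp add: add_mono\<close>)
  qed
  from norm_square_integrable_if_bounded[OF w this] show ?thesis by (simp add: running_cost_def)
qed

(* Testing the trajectory against solutions of the adjoint equation replaces Gronwall's lemma. *)
lemma trajectory_norm_bound: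
  fixes A :: "real^'n^'n" and C :: "real^'m^'n" and U :: "(real^'m) set"
  assumes U: "bounded U"
  obtains b c where "0 \<le> b" "0 \<le> c"
    "\<And>\<Phi> a T x u t. ocp_admissible A C U \<Phi> a T x u \<Longrightarrow> t \<in> {0..T} \<Longrightarrow>
       norm (x t) \<le> exp (b * t) * (norm a + t * c)"
proof -
  define f where "f = (\<lambda>p. - (transpose A *v p))"
  have lf: "linear f"
    by (rule linearI) (auto simp: f_def matrix_vector_right_distrib matrix_vector_mult_scaleR simp del: transpose_matrix_vector)
  obtain b where b: "0 < b" "\<And>x. norm (f x) \<le> b * norm x"
    using linear_bounded_pos[OF lf] by blast
  note fl = lf b(2) less_imp_le[OF b(1)]
  obtain c where c: "0 < c" "\<And>x. norm (C *v x) \<le> c * norm x"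
    using matrix_vector_norm_bound[of C] by blast
  obtain M where M: "0 < M" "\<And>y. y \<in> U \<Longrightarrow> norm y \<le> M" using U by (auto simp: bounded_pos)
  show thesis
  proof (rule that)
    show "0 \<le> b" "0 \<le> c * M" using b c M by auto
    fix \<Phi> a T x u t
    assume adm: "ocp_admissible A C U \<Phi> a T x u" and t: "t \<in> {0..T}"
    obtain v where v: "W11_deriv T x v" "AE t in lebesgue_on {0..T}. v t = A *v x t + C *v u t"
      using adm by (auto simp: ocp_admissible_def trajectory_def)
    have u: "AE t in lebesgue_on {0..T}. u t \<in> U" and x0: "x 0 = a"
      using adm by (auto simp: ocp_admissible_def L1_control_def)
    \<comment> \<open>The adjoint solution that equals \<open>x t\<close> at time t. In the
      derivative of its pairing with x only the control term survives, and the final value of the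
      pairing is the squared norm of \<open>x t\<close>.\<close>
    define y where "y s = flow f (s - t) (x t)" for s
    have y': "(y has_vector_derivative f (y s)) (at s within S)" for s S
    proof -
      have "((\<lambda>r. flow f r (x t)) \<circ> (\<lambda>s. s - t) has_vector_derivative 1 *\<^sub>R f (flow f (s - t) (x t))) (at s within S)"
        by (rule vector_diff_chain_within[OF _ flow_has_vector_derivative[OF fl]])
          (auto intro!: derivative_eq_intros)
      then show ?thesis by (simp add: o_def y_def[abs_def])
    qed
    have cy: "continuous_on {0..T} y"
      unfolding continuous_on_eq_continuous_within by (blast intro: has_vector_derivative_continuous y')
    have "continuous_on {0..T} (\<lambda>s. f (y s))"
      using linear_continuous_on_compose[OF cy lf] by simp
    from W11_deriv_inner_has_integral[OF v(1) y' this, of 0 t] t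
    have i: "((\<lambda>s. v s \<bullet> y s + x s \<bullet> f (y s)) has_integral (x t \<bullet> x t - a \<bullet> y 0)) {0..t}"
      by (simp add: y_def flow_0[OF fl] x0)
    have yb: "norm (y s) \<le> exp (b * t) * norm (x t)" if "s \<in> {0..t}" for s
    proof -
      have "norm (y s) \<le> exp (b * \<bar>s - t\<bar>) * norm (x t)" unfolding y_def by (rule norm_flow_le[OF fl])
      also have "\<dots> \<le> exp (b * t) * norm (x t)" using that b by (intro mult_right_mono) auto
      finally show ?thesis .
    qed
    obtain N where N: "negligible N" "\<And>t. t \<in> {0..T} \<Longrightarrow> t \<notin> N \<Longrightarrow> u t \<in> U"
      using AE_lebesgue_onE[OF u] by blast
    obtain N' where N': "negligible N'" "\<And>t. t \<in> {0..T} \<Longrightarrow> t \<notin> N' \<Longrightarrow> v t = A *v x t + C *v u t"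
      using AE_lebesgue_onE[OF v(2)] by blast
    have "AE s in lebesgue_on {0..t}. norm (v s \<bullet> y s + x s \<bullet> f (y s)) \<le> c * M * (exp (b * t) * norm (x t))"
    proof (rule AE_lebesgue_onI[OF negligible_Un[OF N(1) N'(1)]])
      fix s assume s: "s \<in> {0..t}" "s \<notin> N \<union> N'"
      have "v s = A *v x s + C *v u s" by (rule N'(2)) (use s t in auto)
      then have "v s \<bullet> y s + x s \<bullet> f (y s) = (C *v u s) \<bullet> y s"
        by (simp add: f_def inner_add_left inner_commute[of "A *v _"] inner_commute[of "x s"] flip: dot_lmul_matrix)
      moreover have "norm (C *v u s) \<le> c * M"
      proof -
        have "u s \<in> U" by (rule N(2)) (use s t in auto)
        then show ?thesis using order_trans[OF c(2)[of "u s"] mult_left_mono[OF M(2), of "u s" c]] c(1) by simp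
      qed
      then have "norm (C *v u s) * norm (y s) \<le> c * M * (exp (b * t) * norm (x t))"
        using yb[OF s(1)] c(1) M(1) by (intro mult_mono) auto
      ultimately show "norm (v s \<bullet> y s + x s \<bullet> f (y s)) \<le> c * M * (exp (b * t) * norm (x t))"
        using Cauchy_Schwarz_ineq2[of "C *v u s" "y s"] by simp
    qed
    from norm_has_integral_le_AE[OF i has_integral_const_real this] t
    have "\<bar>x t \<bullet> x t - a \<bullet> y 0\<bar> \<le> t * (c * M * (exp (b * t) * norm (x t)))" by simp
    moreover have "\<bar>a \<bullet> y 0\<bar> \<le> norm a * (exp (b * t) * norm (x t))"
      by (rule order_trans[OF Cauchy_Schwarz_ineq2]) (use yb[of 0] t in \<open>auto intro: mult_left_mono\<close>)
    ultimately have "x t \<bullet> x t \<le> norm a * (exp (b * t) * norm (x t)) + t * (c * M * (exp (b * t) * norm (x t)))"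
      by linarith
    also have "\<dots> = (exp (b * t) * (norm a + t * (c * M))) * norm (x t)" by (simp add: algebra_simps)
    finally have "norm (x t) * norm (x t) \<le> (exp (b * t) * (norm a + t * (c * M))) * norm (x t)"
      by (simp add: dot_square_norm power2_eq_square)
    moreover have "0 \<le> exp (b * t) * (norm a + t * (c * M))" using t c M by simp
    ultimately show "norm (x t) \<le> exp (b * t) * (norm a + t * (c * M))"
      by (cases "x t = 0") (auto simp: mult_le_cancel_right)
  qed
qed

subsection \<open>Null controllability\<close>

text \<open>The form is evaluated at \<open>z\<close> minus \<open>1 / b\<close> times its image
  under Q. With this step size the quadratic term absorbs at most half of the linear one, and what
  is left is the claim. It is used to bound the velocity by the stored energy.\<close>

lemma psd_norm_square_le:
  fixes Q :: "real^'n^'n"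
  assumes "psd Q" "0 < b" "\<And>z. norm (Q *v z) \<le> b * norm z"
  shows "(norm (Q *v z))\<^sup>2 \<le> b * (z \<bullet> (Q *v z))"
proof -
  define w where "w = Q *v z"
  have sym: "x \<bullet> (Q *v y) = (Q *v x) \<bullet> y" for x y
    using assms(1) by (metis dot_lmul_matrix psd_def transpose_matrix_vector)
  have "0 \<le> (z - (1 / b) *\<^sub>R w) \<bullet> (Q *v (z - (1 / b) *\<^sub>R w))"
    using assms(1) by (simp add: psd_def)
  also have "\<dots> = z \<bullet> w - 2 / b * (w \<bullet> w) + (1 / b) * (1 / b) * (w \<bullet> (Q *v w))"
    by (simp add: matrix_vector_mult_diff_distrib matrix_vector_mult_scaleR inner_diff_left inner_diff_right
        sym[of z w] diff_divide_distrib flip: w_def)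
  also have "w \<bullet> (Q *v w) \<le> b * (w \<bullet> w)"
  proof -
    have "w \<bullet> (Q *v w) \<le> norm w * norm (Q *v w)" by (rule norm_cauchy_schwarz)
    also have "\<dots> \<le> norm w * (b * norm w)" by (intro mult_left_mono assms(3)) simp
    finally show ?thesis by (simp add: dot_square_norm power2_eq_square algebra_simps)
  qed
  then have "(1 / b) * (1 / b) * (w \<bullet> (Q *v w)) \<le> (1 / b) * (1 / b) * (b * (w \<bullet> w))"
    by (intro mult_left_mono) auto
  also have "\<dots> = 1 / b * (w \<bullet> w)" using assms(2) by simp
  finally have "1 / b * (w \<bullet> w) \<le> z \<bullet> w" by (simp add: algebra_simps)
  then have "w \<bullet> w \<le> b * (z \<bullet> w)" using assms(2) by (simp add: field_simps)
  then show ?thesis by (simp add: w_def power2_norm_eq_inner)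
qed

text \<open>The stored energy \<open>x \<bullet> Q x\<close> does not increase along the uncontrolled system and controls its
  velocity, so the uncontrolled solutions grow at most linearly.\<close>

lemma uncontrolled_growth_bound:
  fixes J R Q :: "real^'n^'n"
  assumes J: "J = - transpose J" and R: "psd R" and Q: "psd Q"
  obtains k where "0 < k"
    "\<And>y j. norm (((flow ((*v) ((J - R) ** Q)) 1) ^^ j) y) \<le> (1 + k * real j) * norm y"
proof -
  define f where "f = (*v) ((J - R) ** Q)"
  have lf: "linear f" unfolding f_def by (rule matrix_vector_mul_linear)
  obtain B where B: "0 < B" "\<And>x. norm (f x) \<le> B * norm x"
    using linear_bounded_pos[OF lf] by blast
  note fl = lf B(2) less_imp_le[OF B(1)]
  obtain b where b: "0 < b" "\<And>x. norm (Q *v x) \<le> b * norm x"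
    using matrix_vector_norm_bound[of Q] by blast
  obtain c where c: "0 < c" "\<And>x. norm ((J - R) *v x) \<le> c * norm x"
    using matrix_vector_norm_bound[of "J - R"] by blast
  define q where "q x = x \<bullet> (Q *v x)" for x
  have sym: "x \<bullet> (Q *v y) = (Q *v x) \<bullet> y" for x y
    using Q by (metis dot_lmul_matrix psd_def transpose_matrix_vector)
  have q0: "0 \<le> q x" for x using Q by (simp add: q_def psd_def)
  have qb: "q x \<le> b * (norm x)\<^sup>2" for x
  proof -
    have "q x \<le> norm x * norm (Q *v x)" unfolding q_def by (rule norm_cauchy_schwarz)
    also have "\<dots> \<le> norm x * (b * norm x)" by (intro mult_left_mono b) simp
    finally show ?thesis by (simp add: power2_eq_square algebra_simps)
  qed
  have fb: "norm (f x) \<le> c * sqrt (b * q x)" for x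
  proof -
    have "norm (Q *v x) \<le> sqrt (b * q x)"
      using psd_norm_square_le[OF Q b(1,2), of x] by (simp add: q_def real_le_rsqrt)
    then show ?thesis
      using order_trans[OF c(2)[of "Q *v x"] mult_left_mono] c(1)
      by (simp add: f_def flip: matrix_vector_mul_assoc)
  qed
  \<comment> \<open>Half of the power balance: the skew part J contributes nothing and R
    dissipates.\<close>
  have dq: "f x \<bullet> (Q *v x) \<le> 0" for x
  proof -
    define z where "z = Q *v x"
    have "z \<bullet> (J *v z) = (transpose J *v z) \<bullet> z" by (simp add: dot_lmul_matrix)
    also have "transpose J = - J" using J by (metis minus_equation_iff)
    also have "((- J) *v z) \<bullet> z = - (z \<bullet> (J *v z))"
      using matrix_vector_mult_diff_rdistrib[of 0 J z] by (simp add: inner_commute)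
    finally have "z \<bullet> (J *v z) = 0" by simp
    moreover have "0 \<le> z \<bullet> (R *v z)" using R by (simp add: psd_def)
    ultimately have "z \<bullet> ((J - R) *v z) \<le> 0" by (simp add: matrix_vector_mult_diff_rdistrib inner_diff_right)
    then show ?thesis by (simp add: f_def z_def inner_commute matrix_vector_mul_assoc)
  qed
  define F where "F = flow f 1"
  have flow_q: "q (flow f t y) \<le> q y" if "0 \<le> t" for t y
  proof -
    have d: "((\<lambda>t. - q (flow f t y)) has_vector_derivative - (2 * (f (flow f t y) \<bullet> (Q *v flow f t y)))) (at t)" for t
    proof -
      have "((\<lambda>t. Q *v flow f t y) has_vector_derivative Q *v f (flow f t y)) (at t)"
        by (rule bounded_linear.has_vector_derivative[OF matrix_vector_mul_bounded_linear flow_has_vector_derivative[OF fl]])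
      from bounded_bilinear.has_vector_derivative[OF bounded_bilinear_inner flow_has_vector_derivative[OF fl] this]
      have "((\<lambda>t. q (flow f t y)) has_vector_derivative
          flow f t y \<bullet> (Q *v f (flow f t y)) + f (flow f t y) \<bullet> (Q *v flow f t y)) (at t)"
        unfolding q_def .
      moreover have "flow f t y \<bullet> (Q *v f (flow f t y)) = f (flow f t y) \<bullet> (Q *v flow f t y)"
        by (subst sym) (rule inner_commute)
      ultimately show ?thesis by (intro has_vector_derivative_minus) simp
    qed
    have "- q (flow f 0 y) \<le> - q (flow f t y)"
    proof (rule DERIV_nonneg_imp_nondecreasing[OF that])
      fix s
      show "\<exists>z. ((\<lambda>t. - q (flow f t y)) has_real_derivative z) (at s) \<and> 0 \<le> z"
        using d[of s] dq[of "flow f s y"] unfolding has_real_derivative_iff_has_vector_derivative by force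
    qed
    then show ?thesis by (simp add: flow_0[OF fl])
  qed
  have stepn: "norm (F y - y) \<le> c * sqrt (b * q y)" for y
  proof -
    have "((\<lambda>t. f (flow f t y)) has_integral (flow f 1 y - flow f 0 y)) {0..1}"
      by (rule fundamental_theorem_of_calculus) (auto intro: flow_has_vector_derivative[OF fl])
    moreover have "AE t in lebesgue_on {0..1}. norm (f (flow f t y)) \<le> c * sqrt (b * q y)"
    proof (rule AE_I2)
      fix t :: real assume "t \<in> space (lebesgue_on {0..1})"
      then have t: "0 \<le> t" by simp
      show "norm (f (flow f t y)) \<le> c * sqrt (b * q y)"
        by (rule order_trans[OF fb]) (use flow_q[OF t, of y] b c in \<open>simp add: mult_left_mono\<close>)
    qed
    ultimately have "norm (flow f 1 y - flow f 0 y) \<le> Henstock_Kurzweil_Integration.content {0..1::real} *\<^sub>R (c * sqrt (b * q y))"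
      by (rule norm_has_integral_le_AE[OF _ has_integral_const_real])
    then show ?thesis by (simp add: F_def flow_0[OF fl])
  qed
  have qF: "q ((F ^^ j) y) \<le> q y" for j y
  proof (induction j)
    case (Suc j)
    then show ?case using flow_q[of 1 "(F ^^ j) y"] by (simp add: F_def)
  qed simp
  \<comment> \<open>Since the energy has not increased after j steps, each further unit of time
    moves the state by no more than the bound for the first one.\<close>
  have "norm ((F ^^ j) y) \<le> norm y + real j * (c * sqrt (b * q y))" for j y
  proof (induction j)
    case (Suc j)
    have "norm (F ((F ^^ j) y)) \<le> norm ((F ^^ j) y) + norm (F ((F ^^ j) y) - (F ^^ j) y)"
      using norm_triangle_sub by blast
    also have "\<dots> \<le> norm ((F ^^ j) y) + c * sqrt (b * q ((F ^^ j) y))" by (intro add_left_mono stepn)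
    also have "\<dots> \<le> norm ((F ^^ j) y) + c * sqrt (b * q y)"
      using qF[of j y] b c by (intro add_left_mono mult_left_mono) auto
    finally show ?case using Suc by (simp add: algebra_simps)
  qed simp
  moreover have "c * sqrt (b * q y) \<le> c * b * norm y" for y
  proof -
    have "b * q y \<le> (b * norm y)\<^sup>2" using mult_left_mono[OF qb[of y], of b] b(1)
      by (simp add: power2_eq_square mult_ac)
    then have "sqrt (b * q y) \<le> b * norm y" using b(1) by (intro real_le_lsqrt) (auto simp: q0)
    then show ?thesis using c(1) by (simp add: mult.assoc)
  qed
  ultimately have "norm ((F ^^ j) y) \<le> norm y + real j * (c * b * norm y)" for j y
    by (meson add_left_mono mult_left_mono of_nat_0_le_iff order_trans)
  then have "norm ((F ^^ j) y) \<le> (1 + (c * b) * real j) * norm y" for j y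
    by (simp add: algebra_simps)
  then show thesis using that[of "c * b"] c(1) b(1) by (simp add: F_def f_def)
qed

lemma steerable_trans:
  assumes "steerable A C U s a {b}" "steerable A C U r b \<Phi>"
  shows "steerable A C U (s + r) a \<Phi>"
proof -
  obtain x u y w where "ocp_admissible A C U {b} a s x u" "ocp_admissible A C U \<Phi> b r y w" "0 \<le> s" "0 \<le> r"
    using assms by (auto simp: steerable_def ocp_admissible_def)
  from ocp_admissible_glue[OF this] \<open>0 \<le> s\<close> \<open>0 \<le> r\<close> show ?thesis
    by (auto simp: steerable_def ocp_admissible_def)
qed

lemma steerable_smooth:
  fixes A :: "real^'n^'n" and C :: "real^'m^'n"
  assumes "0 \<le> T" "continuous_on UNIV v"
    and "\<And>t s. (\<xi> has_vector_derivative A *v \<xi> t + C *v v t) (at t within s)"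
    and "\<And>t. t \<in> {0..T} \<Longrightarrow> v t \<in> U" and "\<xi> T \<in> \<Phi>"
  shows "steerable A C U T (\<xi> 0) \<Phi>"
  using ocp_admissible_smooth[OF assms] assms(1) by (auto simp: steerable_def ocp_admissible_def)

lemma flow_matrix:
  fixes A :: "real^'n^'n"
  shows "flow ((*v) A) 0 x = x"
    and "((\<lambda>t. flow ((*v) A) t x) has_vector_derivative A *v flow ((*v) A) t x) (at t within s)"
    and "linear (flow ((*v) A) t)"
proof -
  obtain B where B: "0 < B" "\<And>x. norm (A *v x) \<le> B * norm x"
    using matrix_vector_norm_bound[of A] by blast
  note fl = matrix_vector_mul_linear[of A] B(2) less_imp_le[OF B(1)]
  show "flow ((*v) A) 0 x = x"
    and "((\<lambda>t. flow ((*v) A) t x) has_vector_derivative A *v flow ((*v) A) t x) (at t within s)"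
    and "linear (flow ((*v) A) t)"
    by (rule flow_0[OF fl] flow_has_vector_derivative[OF fl] flow_linear[OF fl])+
qed

text \<open>By superposition with the free solution, the control only has to steer 0 to
  \<open>z\<close>. Its size depends on \<open>z\<close> alone, so the same \<epsilon> serves for
  every initial state \<open>a\<close>.\<close>

lemma steerable_near_flow:
  fixes A :: "real^'n^'n" and C :: "real^'m^'n"
  assumes ctrl: "controllable A C" and U: "0 \<in> interior U"
  obtains \<epsilon> where "0 < \<epsilon>"
    "\<And>a z. norm z \<le> \<epsilon> \<Longrightarrow> steerable A C U 1 a {flow ((*v) A) 1 a + z}"
proof -
  obtain r where r: "0 < r" "cball 0 r \<subseteq> U" using U mem_interior_cball by blast
  obtain K where K: "0 < K"
    "\<And>a b. \<exists>\<xi> v. \<xi> 0 = a \<and> \<xi> 1 = b \<and> continuous_on UNIV v \<and>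
        (\<forall>t s. (\<xi> has_vector_derivative A *v \<xi> t + C *v v t) (at t within s)) \<and>
        (\<forall>t\<in>{0..1}. norm (\<xi> t) \<le> K * (norm a + norm b) \<and> norm (v t) \<le> K * (norm a + norm b))"
    using steering[OF ctrl zero_less_one] by blast
  show thesis
  proof (rule that[of "r / K"])
    show "0 < r / K" using r K by simp
    fix a z :: "real^'n" assume z: "norm z \<le> r / K"
    obtain \<xi> v where v: "\<xi> 0 = 0" "\<xi> 1 = z" "continuous_on UNIV v"
      "\<And>t s. (\<xi> has_vector_derivative A *v \<xi> t + C *v v t) (at t within s)"
      "\<And>t. t \<in> {0..1} \<Longrightarrow> norm (v t) \<le> K * (norm (0::real^'n) + norm z)"
      using K(2)[of 0 z] by blast
    define x where "x t = flow ((*v) A) t a + \<xi> t" for t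
    have "steerable A C U 1 (x 0) {flow ((*v) A) 1 a + z}"
    proof (rule steerable_smooth[OF _ v(3)])
      show "(x has_vector_derivative A *v x t + C *v v t) (at t within s)" for t s
        using has_vector_derivative_add[OF flow_matrix(2)[of A a t s] v(4)[of t s]]
        by (simp add: x_def[abs_def] matrix_vector_right_distrib add.assoc)
      show "v t \<in> U" if "t \<in> {0..1}" for t
      proof -
        have "norm (v t) \<le> K * norm z" using v(5)[OF that] by simp
        also have "\<dots> \<le> r" using z K(1) by (simp add: field_simps)
        finally show ?thesis using r(2) by auto
      qed
    qed (simp_all add: x_def v)
    then show "steerable A C U 1 a {flow ((*v) A) 1 a + z}" by (simp add: x_def v flow_matrix)
  qed
qed

text \<open>Uncontrolled solutions grow at most linearly, so the \<open>j\<close>-th unit of time suffices to shrink the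
  state by an additional amount of order \<open>1 / j\<close> relative to the uncontrolled solution.  As the
  harmonic series diverges, zero is reached.\<close>

lemma null_controllable:
  fixes J R Q :: "real^'n^'n" and C :: "real^'m^'n"
  assumes J: "J = - transpose J" "psd R" "psd Q" and A: "A = (J - R) ** Q"
    and ctrl: "controllable A C" and U: "0 \<in> interior U"
  obtains \<kappa> where "0 < \<kappa>"
    "\<And>a. \<exists>t. t \<le> exp (\<kappa> * (1 + norm a) + 1) + 1 \<and> steerable A C U t a {0}"
proof -
  obtain k where k: "0 < k" "\<And>y j. norm ((flow ((*v) A) 1 ^^ j) y) \<le> (1 + k * real j) * norm y"
    using uncontrolled_growth_bound[OF J] A by metis
  obtain \<epsilon> where e: "0 < \<epsilon>"
    "\<And>a z. norm z \<le> \<epsilon> \<Longrightarrow> steerable A C U 1 a {flow ((*v) A) 1 a + z}"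
    using steerable_near_flow[OF ctrl U] by blast
  define F where "F = flow ((*v) A) 1"
  have lF: "linear F" unfolding F_def by (rule flow_matrix)
  \<comment> \<open>The ratio of the growth factor of free solutions to the size of a correction
    that one unit of time allows.\<close>
  define \<kappa> where "\<kappa> = (1 + k) / \<epsilon>"
  have kap: "0 < \<kappa>" using k e by (simp add: \<kappa>_def)
  show thesis
  proof (rule that[OF kap])
    fix a :: "real^'n"
    \<comment> \<open>Chosen so that shrinking the factor by \<open>\<delta> / (real j + 2)\<close>
      in step j needs a correction of norm at most \<epsilon>.\<close>
    define \<delta> where "\<delta> = 1 / (\<kappa> * (1 + norm a))"
    have d0: "0 < \<delta>" using kap by (simp add: \<delta>_def add_pos_nonneg)
    \<comment> \<open>The offset 2 makes the denominators dominate the growth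
      \<open>1 + k * real (Suc j)\<close> up to the factor \<open>1 + k\<close>, and it turns h into
      a harmonic sum without its first term.\<close>
    define h where "h j = (\<Sum>i<j. 1 / (real i + 2))" for j
    \<comment> \<open>The factor left on the free solution after j steps. The maximum stops it
      exactly at 0 when the last correction would overshoot.\<close>
    define s where "s j = max 0 (1 - \<delta> * h j)" for j
    have reach: "steerable A C U (real j) a {s j *\<^sub>R (F ^^ j) a}" for j
    proof (induction j)
      case 0
      have "steerable A C U 0 (flow ((*v) A) 0 a) {a}"
        by (rule steerable_smooth[where v = "\<lambda>_. 0"])
          (use flow_matrix interior_subset[of U] U in \<open>auto simp: matrix_vector_mult_0_right\<close>)
      then show ?case by (simp add: flow_matrix s_def h_def)
    next
      case (Suc j)
      define z where "z = (s (Suc j) - s j) *\<^sub>R (F ^^ Suc j) a"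
      have "\<bar>s (Suc j) - s j\<bar> \<le> \<delta> / (real j + 2)"
      proof -
        have "\<delta> * h (Suc j) = \<delta> * h j + \<delta> / (real j + 2)" by (simp add: h_def distrib_left)
        moreover have "0 \<le> \<delta> / (real j + 2)" using d0 by simp
        ultimately show ?thesis unfolding s_def by linarith
      qed
      moreover have "norm ((F ^^ Suc j) a) \<le> (1 + k) * (real j + 2) * (1 + norm a)"
      proof -
        have "norm ((F ^^ Suc j) a) \<le> (1 + k * real (Suc j)) * norm a" unfolding F_def by (rule k)
        also have "\<dots> \<le> ((1 + k) * (real j + 2)) * (1 + norm a)"
          using k by (intro mult_mono) (auto simp: algebra_simps)
        finally show ?thesis .
      qed
      ultimately have "norm z \<le> \<delta> / (real j + 2) * ((1 + k) * (real j + 2) * (1 + norm a))"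
        unfolding z_def norm_scaleR by (intro mult_mono) (use d0 in auto)
      also have "\<dots> = \<epsilon>"
      proof -
        have "\<delta> * ((1 + k) * (1 + norm a)) = \<epsilon>"
          using k(1) e(1) norm_ge_zero[of a] by (simp add: \<delta>_def \<kappa>_def field_simps add_nonneg_eq_0_iff)
        moreover have "\<delta> / c * ((1 + k) * c * (1 + norm a)) = \<delta> * ((1 + k) * (1 + norm a))" if "c \<noteq> 0" for c
          using that by simp
        ultimately show ?thesis by (simp add: add_nonneg_eq_0_iff)
      qed
      finally have "steerable A C U 1 (s j *\<^sub>R (F ^^ j) a) {F (s j *\<^sub>R (F ^^ j) a) + z}"
        unfolding F_def by (rule e)
      also have "F (s j *\<^sub>R (F ^^ j) a) + z = s (Suc j) *\<^sub>R (F ^^ Suc j) a"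
        by (simp add: z_def linear_cmul[OF lF] algebra_simps)
      finally show ?case using steerable_trans[OF Suc] by (simp add: add.commute)
    qed
    \<comment> \<open>The logarithm of n bounds the harmonic sum from below; the summand 1 in the
      exponent compensates for the term 1 that is missing from h.\<close>
    define n where "n = nat \<lceil>exp (1 / \<delta> + 1)\<rceil>"
    have n: "exp (1 / \<delta> + 1) \<le> real n" unfolding n_def by linarith
    have n': "real n \<le> exp (1 / \<delta> + 1) + 1" unfolding n_def using exp_ge_zero[of "1 / \<delta> + 1"] by linarith
    have "h n = harm (Suc n) - 1"
    proof -
      have "h j = harm (Suc j) - 1" for j
        by (induction j) (auto simp: h_def harm_Suc harm_def[of 0] inverse_eq_divide add_ac)
      then show ?thesis .
    qed
    moreover have "1 / \<delta> + 1 \<le> harm (Suc n)"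
    proof -
      have "1 / \<delta> + 1 \<le> ln (real n)" using n exp_gt_zero[of "1 / \<delta> + 1"]
        by (subst ln_ge_iff) linarith+
      also have "\<dots> \<le> ln (real (Suc n) + 1)" using n exp_gt_zero[of "1 / \<delta> + 1"]
        by (subst ln_le_cancel_iff) linarith+
      also have "\<dots> \<le> harm (Suc n)" by (rule ln_le_harm)
      finally show ?thesis .
    qed
    ultimately have "1 / \<delta> \<le> h n" by simp
    then have "s n = 0" using d0 by (simp add: s_def field_simps)
    then have "steerable A C U (real n) a {0}" using reach[of n] by simp
    moreover have "1 / \<delta> = \<kappa> * (1 + norm a)" by (simp add: \<delta>_def)
    ultimately show "\<exists>t. t \<le> exp (\<kappa> * (1 + norm a) + 1) + 1 \<and> steerable A C U t a {0}"
      using n' by auto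
  qed
qed

subsection \<open>The optimal cost\<close>

lemma running_cost_nonneg: "0 \<le> running_cost W x u"
  by (simp add: running_cost_def)

lemma running_cost_0: "running_cost W (0::real^'a) (0::real^'b) = 0"
proof -
  have "stack (0::real^'a) (0::real^'b) = 0" by (simp add: stack_def vec_eq_iff split: sum.split)
  then show ?thesis by (simp add: running_cost_def)
qed

lemma integral_running_cost_le:
  assumes adm: "ocp_admissible A C U \<Phi> a T x u" and T: "0 \<le> T"
    and X: "\<And>t. t \<in> {0..T} \<Longrightarrow> norm (x t) \<le> X" and M: "\<And>y. y \<in> U \<Longrightarrow> norm y \<le> M"
    and c: "0 < c" "\<And>x u. norm (psd_sqrt W *v stack x u) \<le> c * (norm x + norm u)"
  shows "integral {0..T} (\<lambda>t. running_cost W (x t) (u t)) \<le> T * (c * (X + M))\<^sup>2"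
proof -
  have U: "bounded U" using M by (auto simp: bounded_iff)
  have u: "AE t in lebesgue_on {0..T}. u t \<in> U"
    using adm by (auto simp: ocp_admissible_def L1_control_def)
  obtain N where N: "negligible N" "\<And>t. t \<in> {0..T} \<Longrightarrow> t \<notin> N \<Longrightarrow> u t \<in> U"
    using AE_lebesgue_onE[OF u] by blast
  have "AE t in lebesgue_on {0..T}. norm (running_cost W (x t) (u t)) \<le> (c * (X + M))\<^sup>2"
  proof (rule AE_lebesgue_onI[OF N(1)])
    fix t assume t: "t \<in> {0..T}" "t \<notin> N"
    have "norm (psd_sqrt W *v stack (x t) (u t)) \<le> c * (X + M)"
      by (rule order_trans[OF c(2)]) (use c(1) X[OF t(1)] M[OF N(2)[OF t]] in \<open>simp add: add_mono\<close>)
    then show "norm (running_cost W (x t) (u t)) \<le> (c * (X + M))\<^sup>2"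
      by (simp add: running_cost_def power_mono)
  qed
  from norm_has_integral_le_AE[OF integrable_integral[OF running_cost_integrable[OF adm U]]
      has_integral_const_real this] T
  show ?thesis by simp
qed

lemma optimal_running_cost_bound:
  fixes J R Q :: "real^'n^'n" and C :: "real^'m^'n" and U :: "(real^'m) set"
  assumes J: "J = - transpose J" "psd R" "psd Q" and A: "A = (J - R) ** Q"
    and ctrl: "controllable A C" and U: "0 \<in> interior U" "bounded U"
    and T1: "steerable A C U T1 0 \<Phi>"
  obtains F where "continuous_on UNIV F" "\<And>a. 0 \<le> F a"
    "\<And>a T x u. min_time_to_zero A C U a + T1 < T \<Longrightarrow> ocp_optimal A C Q W U \<Phi> a T x u \<Longrightarrow>
       integral {0..T} (\<lambda>t. running_cost W (x t) (u t)) \<le> F a"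
proof -
  obtain \<kappa> where kap: "0 < \<kappa>"
    "\<And>a. \<exists>t. t \<le> exp (\<kappa> * (1 + norm a) + 1) + 1 \<and> steerable A C U t a {0}"
    using null_controllable[OF J A ctrl U(1)] by blast
  obtain b e where be: "0 \<le> b" "0 \<le> e" "\<And>\<Phi> a T x u t. ocp_admissible A C U \<Phi> a T x u \<Longrightarrow> t \<in> {0..T} \<Longrightarrow>
       norm (x t) \<le> exp (b * t) * (norm a + t * e)"
    using trajectory_norm_bound[OF U(2), of A C] by blast
  obtain c where c: "0 < c" "\<And>x u. norm (psd_sqrt W *v stack x u) \<le> c * (norm x + norm u)"
    using stack_norm_bound[of "psd_sqrt W"] by blast
  obtain M where M: "0 < M" "\<And>y. y \<in> U \<Longrightarrow> norm y \<le> M" using U(2) by (auto simp: bounded_pos)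
  obtain y w where yw: "ocp_admissible A C U \<Phi> 0 T1 y w" and T10: "0 \<le> T1"
    using T1 by (auto simp: steerable_def ocp_admissible_def)
  \<comment> \<open>The cost of the last phase. This phase starts at 0 and takes time
    \<open>T1\<close> for every initial state and horizon, so E is one constant.\<close>
  define E where "E = 1/2 * (y T1 \<bullet> (Q *v y T1)) + integral {0..T1} (\<lambda>t. running_cost W (y t) (w t))"
  \<comment> \<open>One more than the time bound for steering to 0, so that the minimal time lies
    strictly below \<tau> and a steering time can still be picked below it.\<close>
  define \<tau> where "\<tau> a = exp (\<kappa> * (1 + norm a) + 1) + 2" for a :: "real^'n"
  define X where "X a = exp (b * \<tau> a) * (norm a + \<tau> a * e)" for a
  define F where "F a = \<bar>E\<bar> + \<tau> a * (c * (X a + M))\<^sup>2" for a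
  have tau0: "0 \<le> \<tau> a" for a by (simp add: \<tau>_def)
  show thesis
  proof (rule that)
    show "continuous_on UNIV F" unfolding F_def X_def \<tau>_def by (intro continuous_intros)
    show "0 \<le> F a" for a using tau0 by (simp add: F_def)
    fix a T x u
    assume T: "min_time_to_zero A C U a + T1 < T" and opt: "ocp_optimal A C Q W U \<Phi> a T x u"
    define S where "S = {t. steerable A C U t a {0}}"
    obtain t where "t \<le> exp (\<kappa> * (1 + norm a) + 1) + 1" "steerable A C U t a {0}" using kap(2) by blast
    then have t: "t \<le> \<tau> a - 1" "t \<in> S" by (simp_all add: S_def \<tau>_def)
    have "bdd_below S" by (rule bdd_belowI[of _ 0]) (auto simp: S_def steerable_def)
    then have "Inf S \<le> \<tau> a - 1" using t cInf_lower by fastforce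
    \<comment> \<open>The infimum need not be attained, but a steering time \<open>s\<close> below
      both bounds exists. The first bound makes the competitor fit into the horizon, the second
      bounds the cost of its first phase; the time in between is spent at 0 free of cost.\<close>
    then have "Inf S < min (T - T1) (\<tau> a)" using T by (simp add: min_time_to_zero_def S_def)
    then obtain s where s: "s \<in> S" "s < T - T1" "s < \<tau> a" using cInf_lessD[of S "min (T - T1) (\<tau> a)"] t by auto
    obtain x1 u1 where x1: "ocp_admissible A C U {0} a s x1 u1" and s0: "0 \<le> s"
      using s(1) by (auto simp: S_def steerable_def ocp_admissible_def)
    have "0 \<in> U" using U(1) interior_subset by blast
    then have z: "ocp_admissible A C U {0} 0 (T - T1 - s) (\<lambda>_. 0) (\<lambda>_. 0)"
      using ocp_admissible_smooth[of "T - T1 - s" "\<lambda>_. 0" "\<lambda>_. 0" A C U "{0}"] s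
      by (simp add: matrix_vector_mult_0_right)
    define x2 u2 where "x2 = glue s x1 (\<lambda>_. 0)" and "u2 = glue s u1 (\<lambda>_. 0)"
    define x3 u3 where "x3 = glue (T - T1) x2 y" and "u3 = glue (T - T1) u2 w"
    have x2: "ocp_admissible A C U {0} a (T - T1) x2 u2"
      using ocp_admissible_glue[OF x1 z s0] s by (simp add: x2_def u2_def)
    have x3: "ocp_admissible A C U \<Phi> a T x3 u3"
      using ocp_admissible_glue[OF x2 yw] s s0 T10 by (simp add: x3_def u3_def)
    define i1 i3 where "i1 = integral {0..s} (\<lambda>t. running_cost W (x1 t) (u1 t))"
      and "i3 = integral {0..T1} (\<lambda>t. running_cost W (y t) (w t))"
    have "((\<lambda>t. running_cost W (x2 t) (u2 t)) has_integral i1 + 0) {0..s + (T - T1 - s)}"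
      unfolding x2_def u2_def glue_compose2[of "running_cost W"] i1_def
      by (rule has_integral_glue[OF integrable_integral[OF running_cost_integrable[OF x1 U(2)]]])
        (use s s0 in \<open>simp_all add: running_cost_0\<close>)
    then have h2: "((\<lambda>t. running_cost W (x2 t) (u2 t)) has_integral i1) {0..T - T1}" by simp
    have "((\<lambda>t. running_cost W (x3 t) (u3 t)) has_integral i1 + i3) {0..(T - T1) + T1}"
      unfolding x3_def u3_def glue_compose2[of "running_cost W"] i3_def
      by (rule has_integral_glue[OF h2 integrable_integral[OF running_cost_integrable[OF yw U(2)]]])
        (use s s0 T10 in simp_all)
    then have "integral {0..T} (\<lambda>t. running_cost W (x3 t) (u3 t)) = i1 + i3" by (simp add: integral_unique)
    moreover have "x3 T = y T1" using T10 by (simp add: x3_def glue_right)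
    ultimately have "ocp_cost Q W T x3 u3 = E + i1" by (simp add: ocp_cost_def E_def i3_def)
    moreover have "ocp_cost Q W T x u \<le> ocp_cost Q W T x3 u3"
      using opt x3 by (simp add: ocp_optimal_def)
    \<comment> \<open>The terminal cost of the optimal pair may be dropped, which leaves a bound on
      the integral of its running cost alone.\<close>
    moreover have "0 \<le> x T \<bullet> (Q *v x T)" using J(3) by (simp add: psd_def)
    ultimately have le: "integral {0..T} (\<lambda>t. running_cost W (x t) (u t)) \<le> E + i1" by (simp add: ocp_cost_def)
    have "norm (x1 t) \<le> X a" if t: "t \<in> {0..s}" for t
    proof -
      have "norm (x1 t) \<le> exp (b * t) * (norm a + t * e)" by (rule be(3)[OF x1 t])
      also have "\<dots> \<le> X a"
        unfolding X_def using t s be(1,2)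
        by (intro mult_mono add_left_mono mult_right_mono) (auto intro: mult_left_mono)
      finally show ?thesis .
    qed
    from integral_running_cost_le[OF x1 s0 this M(2) c]
    have "i1 \<le> s * (c * (X a + M))\<^sup>2" by (simp add: i1_def)
    also have "\<dots> \<le> \<tau> a * (c * (X a + M))\<^sup>2" using s by (intro mult_right_mono) auto
    finally show "integral {0..T} (\<lambda>t. running_cost W (x t) (u t)) \<le> F a" using le by (simp add: F_def)
  qed
qed

subsection \<open>The adjoint state\<close>

text \<open>The derivative is taken jointly in state and control, so that the adjoint equation and
  the stationarity in the control become restrictions of one linear map and can be added.\<close>

lemma hamiltonian_has_derivative:
  fixes A :: "real^'n^'n" and C :: "real^'m^'n"
  shows "((\<lambda>p. hamiltonian A C W (fst p) (snd p) l l0) has_derivative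
    (\<lambda>h. l \<bullet> (A *v fst h + C *v snd h) +
      2 * l0 * ((psd_sqrt W *v stack x u) \<bullet> (psd_sqrt W *v stack (fst h) (snd h))))) (at (x, u))"
proof -
  define \<phi> where "\<phi> p = psd_sqrt W *v stack (fst p) (snd p)" for p :: "(real^'n) \<times> (real^'m)"
  define L where "L p = l \<bullet> (A *v fst p + C *v snd p)" for p
  have "linear \<phi>" unfolding \<phi>_def by (rule stack_linear)
  then have d: "(\<phi> has_derivative \<phi>) (at p)" for p
    by (simp add: linear_imp_has_derivative)
  have "linear L"
    by (rule linearI) (auto simp: L_def matrix_vector_right_distrib matrix_vector_mult_scaleR inner_add_right algebra_simps)
  then have dL: "(L has_derivative L) (at p)" for p by (simp add: linear_imp_has_derivative)
  have "((\<lambda>p. L p + l0 * (\<phi> p \<bullet> \<phi> p)) has_derivative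
      (\<lambda>h. L h + l0 * (\<phi> (x, u) \<bullet> \<phi> h + \<phi> h \<bullet> \<phi> (x, u)))) (at (x, u))"
    by (intro has_derivative_add dL has_derivative_mult_right has_derivative_inner d)
  then show ?thesis
    by (simp add: L_def \<phi>_def hamiltonian_def running_cost_def power2_norm_eq_inner inner_commute
        algebra_simps)
qed

text \<open>Adding the adjoint equation and the stationarity in the interior of \<open>U\<close>, the terms with \<open>A\<close> and
  \<open>C\<close> cancel: the pairing of the adjoint state with any solution of the control system changes only
  through the output \<open>psd_sqrt W *v stack x u\<close>, whose square is the running cost.\<close>

lemma stationary_adjoint_pairing:
  fixes A :: "real^'n^'n" and C :: "real^'m^'n"
  assumes g: "GDERIV (\<lambda>z. hamiltonian A C W z u l l0) x :> - dl"
    and m: "is_arg_max (\<lambda>w. hamiltonian A C W x w l l0) (\<lambda>w. w \<in> U) u"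
    and u: "u \<in> interior U"
  shows "dl \<bullet> \<xi> + l \<bullet> (A *v \<xi> + C *v v) =
    - 2 * l0 * ((psd_sqrt W *v stack x u) \<bullet> (psd_sqrt W *v stack \<xi> v))"
proof -
  define H where "H p = hamiltonian A C W (fst p) (snd p) l l0" for p
  define D where "D h = l \<bullet> (A *v fst h + C *v snd h) +
      2 * l0 * ((psd_sqrt W *v stack x u) \<bullet> (psd_sqrt W *v stack (fst h) (snd h)))" for h
  have HD: "(H has_derivative D) (at (x, u))"
    unfolding H_def D_def by (rule hamiltonian_has_derivative)
  have "((\<lambda>z. H (z, u)) has_derivative (\<lambda>h. D (h, 0))) (at x)"
    by (rule has_derivative_compose[of "\<lambda>z. (z, u)" "\<lambda>h. (h, 0)" x UNIV H D, OF _ HD])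
      (auto intro!: derivative_eq_intros)
  moreover have "((\<lambda>z. H (z, u)) has_derivative (\<lambda>h. h \<bullet> (- dl))) (at x)"
    using g by (simp add: gderiv_def H_def)
  ultimately have "(\<lambda>h. D (h, 0)) = (\<lambda>h. h \<bullet> (- dl))" by (rule has_derivative_unique)
  then
  have 1: "D (\<xi>, 0) = \<xi> \<bullet> (- dl)"
    by (simp add: fun_eq_iff)
  have "((\<lambda>w. H (x, w)) has_derivative (\<lambda>h. D (0, h))) (at u)"
    by (rule has_derivative_compose[of "\<lambda>w. (x, w)" "\<lambda>h. (0, h)" u UNIV H D, OF _ HD])
      (auto intro!: derivative_eq_intros)
  moreover have "\<forall>w\<in>interior U. H (x, w) \<le> H (x, u)"
    using m interior_subset[of U] by (auto simp: is_arg_max_def H_def not_less)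
  ultimately have "(\<lambda>h. D (0, h)) = (\<lambda>h. 0)"
    by (intro differential_zero_maxmin[OF u open_interior]) auto
  then have 2: "D (0, v) = 0" by (simp add: fun_eq_iff)
  have "D (\<xi>, v) = D (\<xi>, 0) + D (0, v)"
    using linear_add[OF has_derivative_linear[OF HD], of "(\<xi>, 0)" "(0, v)"] by simp
  then show ?thesis
    unfolding 1 2 by (simp add: D_def inner_commute)
qed

text \<open>\<kappa> depends on the system, on \<open>d\<close> and on \<open>l0\<close>, but
  neither on the trajectory nor on the position of the window. It is proportional to the square of
  \<open>l0\<close>, in accordance with the scaling of the multipliers.\<close>

lemma adjoint_window_bound:
  fixes A :: "real^'n^'n" and C :: "real^'m^'n" and U :: "(real^'m) set"
  assumes ctrl: "controllable A C" and U: "bounded U" and d: "0 < d"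
  obtains \<kappa> where "0 \<le> \<kappa>"
    "\<And>\<Phi> a T x u l tc p t. necessary_conditions A C W U T x u l l0 \<Longrightarrow> ocp_admissible A C U \<Phi> a T x u \<Longrightarrow>
       AE t in lebesgue_on {tc..T - tc}. u t \<in> interior U \<Longrightarrow> 0 \<le> tc \<Longrightarrow> tc \<le> p \<Longrightarrow> p + d \<le> T - tc \<Longrightarrow>
       t = p \<or> t = p + d \<Longrightarrow>
       (norm (l t))\<^sup>2 \<le> \<kappa> * integral {p..p + d} (\<lambda>s. running_cost W (x s) (u s))"
proof -
  obtain K where K: "0 < K"
    "\<And>a b. \<exists>\<xi> v. \<xi> 0 = a \<and> \<xi> d = b \<and> continuous_on UNIV v \<and>
        (\<forall>t s. (\<xi> has_vector_derivative A *v \<xi> t + C *v v t) (at t within s)) \<and>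
        (\<forall>t\<in>{0..d}. norm (\<xi> t) \<le> K * (norm a + norm b) \<and> norm (v t) \<le> K * (norm a + norm b))"
    using steering[OF ctrl d] by blast
  obtain c where c: "0 < c" "\<And>x u. norm (psd_sqrt W *v stack x u) \<le> c * (norm x + norm u)"
    using stack_norm_bound[of "psd_sqrt W"] by blast
  \<comment> \<open>The derivative of the pairing is at most B times \<open>norm z\<close> times the
    norm of the output: \<open>2 * \<bar>l0\<bar>\<close> comes from the pairing identity,
    \<open>c * (2 * K)\<close> bounds the output of the steered solution relative to
    \<open>norm z\<close>.\<close>
  define B where "B = 2 * \<bar>l0\<bar> * (c * (2 * K))"
  have B0: "0 \<le> B" using c K by (simp add: B_def)
  show thesis
  proof (rule that)
    show "0 \<le> d * B\<^sup>2" using d by simp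
    fix \<Phi> a T x u l tc p t
    assume nc: "necessary_conditions A C W U T x u l l0" and adm: "ocp_admissible A C U \<Phi> a T x u"
      and int: "AE t in lebesgue_on {tc..T - tc}. u t \<in> interior U"
      and tc: "0 \<le> tc" "tc \<le> p" "p + d \<le> T - tc" and t: "t = p \<or> t = p + d"
    define \<rho> where "\<rho> s = running_cost W (x s) (u s)" for s
    have rho: "\<rho> integrable_on {p..p + d}"
      unfolding \<rho>_def by (rule integrable_on_subinterval[OF running_cost_integrable[OF adm U]]) (use tc d in auto)
    obtain dx dl where dl: "W11_deriv T l dl" and ae: "AE t in lebesgue_on {0..T}.
           GDERIV (\<lambda>p. hamiltonian A C W (x t) (u t) p l0) (l t) :> dx t \<and>
           GDERIV (\<lambda>z. hamiltonian A C W z (u t) (l t) l0) (x t) :> - dl t \<and>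
           is_arg_max (\<lambda>w. hamiltonian A C W (x t) w (l t) l0) (\<lambda>w. w \<in> U) (u t)"
      using nc unfolding necessary_conditions_def by blast
    define stat where "stat t \<longleftrightarrow> GDERIV (\<lambda>z. hamiltonian A C W z (u t) (l t) l0) (x t) :> - dl t \<and>
           is_arg_max (\<lambda>w. hamiltonian A C W (x t) w (l t) l0) (\<lambda>w. w \<in> U) (u t)" for t
    have "AE t in lebesgue_on {0..T}. stat t"
      using ae by eventually_elim (simp only: stat_def)
    then obtain N where N: "negligible N" "\<And>t. t \<in> {0..T} \<Longrightarrow> t \<notin> N \<Longrightarrow> stat t"
      using AE_lebesgue_onE[of stat 0 T] by blast
    obtain N' where N': "negligible N'" "\<And>t. t \<in> {tc..T - tc} \<Longrightarrow> t \<notin> N' \<Longrightarrow> u t \<in> interior U"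
      using AE_lebesgue_onE[OF int] by metis
    define z where "z = l t"
    \<comment> \<open>Steer from z to 0 if t is the left end of the window and from 0 to z if it is
      the right end. In both cases one boundary term vanishes and the other is the square of
      \<open>norm z\<close> up to sign.\<close>
    obtain a b where ab: "norm a + norm b = norm z" "\<bar>l (p + d) \<bullet> b - l p \<bullet> a\<bar> = (norm z)\<^sup>2"
    proof (cases "t = p")
      case True
      then show ?thesis using that[of z 0] by (simp add: z_def power2_norm_eq_inner)
    next
      case False
      then show ?thesis using that[of 0 z] t by (simp add: z_def power2_norm_eq_inner)
    qed
    obtain \<xi> v where xi: "\<xi> 0 = a" "\<xi> d = b" "continuous_on UNIV v"
      "\<And>t s. (\<xi> has_vector_derivative A *v \<xi> t + C *v v t) (at t within s)"
      "\<And>t. t \<in> {0..d} \<Longrightarrow> norm (\<xi> t) \<le> K * norm z" "\<And>t. t \<in> {0..d} \<Longrightarrow> norm (v t) \<le> K * norm z"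
      using K(2)[of a b] unfolding ab(1) by blast
    define \<eta> \<omega> where "\<eta> s = \<xi> (s - p)" and "\<omega> s = v (s - p)" for s
    have eta: "(\<eta> has_vector_derivative A *v \<eta> s + C *v \<omega> s) (at s within S)" for s S
    proof -
      have "(\<xi> \<circ> (\<lambda>s. s - p) has_vector_derivative 1 *\<^sub>R (A *v \<xi> (s - p) + C *v v (s - p))) (at s within S)"
        by (rule vector_diff_chain_within[OF _ xi(4)]) (auto intro!: derivative_eq_intros)
      then show ?thesis by (simp add: o_def \<eta>_def[abs_def] \<omega>_def)
    qed
    have "continuous_on {0..T} \<eta>"
      unfolding continuous_on_eq_continuous_within by (blast intro: has_vector_derivative_continuous eta)
    moreover have "continuous_on {0..T} \<omega>"
      unfolding \<omega>_def by (rule continuous_on_compose2[OF xi(3)]) (auto intro!: continuous_intros)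
    ultimately have cd: "continuous_on {0..T} (\<lambda>t. A *v \<eta> t + C *v \<omega> t)"
      by (intro continuous_on_add matrix_vector_mult_linear_continuous_on[THEN continuous_on_compose2]) auto
    have i: "((\<lambda>s. dl s \<bullet> \<eta> s + l s \<bullet> (A *v \<eta> s + C *v \<omega> s)) has_integral
        (l (p + d) \<bullet> b - l p \<bullet> a)) {p..p + d}"
      using W11_deriv_inner_has_integral[OF dl eta cd, of p "p + d"] tc d by (simp add: \<eta>_def xi)
    have "((\<lambda>s. (norm z)\<^sup>2 / (2 * d) + d / 2 * B\<^sup>2 * \<rho> s) has_integral
        d * ((norm z)\<^sup>2 / (2 * d)) + d / 2 * B\<^sup>2 * integral {p..p + d} \<rho>) {p..p + d}"
      using has_integral_add[OF has_integral_const_real[of "(norm z)\<^sup>2 / (2 * d)" p "p + d"]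
          has_integral_mult_right[OF integrable_integral[OF rho], of "d / 2 * B\<^sup>2"]] d by simp
    moreover have "AE s in lebesgue_on {p..p + d}. norm (dl s \<bullet> \<eta> s + l s \<bullet> (A *v \<eta> s + C *v \<omega> s))
        \<le> (norm z)\<^sup>2 / (2 * d) + d / 2 * B\<^sup>2 * \<rho> s"
    proof (rule AE_lebesgue_onI[OF negligible_Un[OF N(1) N'(1)]])
      fix s assume s: "s \<in> {p..p + d}" "s \<notin> N \<union> N'"
      have n: "GDERIV (\<lambda>z. hamiltonian A C W z (u s) (l s) l0) (x s) :> - dl s"
        "is_arg_max (\<lambda>w. hamiltonian A C W (x s) w (l s) l0) (\<lambda>w. w \<in> U) (u s)"
        using N(2)[of s] s tc unfolding stat_def by auto
      have ui: "u s \<in> interior U" by (rule N'(2)) (use s tc in auto)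
      define w where "w = psd_sqrt W *v stack (x s) (u s)"
      define w' where "w' = psd_sqrt W *v stack (\<eta> s) (\<omega> s)"
      have "norm w' \<le> c * (norm (\<eta> s) + norm (\<omega> s))" unfolding w'_def by (rule c)
      also have "\<dots> \<le> c * (K * norm z + K * norm z)"
        using xi(5,6)[of "s - p"] s c(1) unfolding \<eta>_def \<omega>_def by (intro mult_left_mono add_mono) auto
      finally have w': "norm w' \<le> c * (2 * K) * norm z" by (simp add: algebra_simps)
      have "norm (dl s \<bullet> \<eta> s + l s \<bullet> (A *v \<eta> s + C *v \<omega> s)) = 2 * \<bar>l0\<bar> * \<bar>w \<bullet> w'\<bar>"
        unfolding stationary_adjoint_pairing[OF n ui] by (simp add: w_def w'_def abs_mult)
      also have "\<dots> \<le> 2 * \<bar>l0\<bar> * (norm w * (c * (2 * K) * norm z))"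
        using w' by (intro mult_left_mono order_trans[OF Cauchy_Schwarz_ineq2]) auto
      also have "\<dots> = B * norm z * norm w" by (simp add: B_def)
      \<comment> \<open>Young's inequality, weighted so that the first term integrates over the
        window of length d to one half of the square of \<open>norm z\<close>, which is absorbed on
        the left.\<close>
      also have "\<dots> \<le> (norm z)\<^sup>2 / (2 * d) + d / 2 * B\<^sup>2 * (norm w)\<^sup>2"
      proof -
        have "0 \<le> (norm z - d * B * norm w)\<^sup>2 / (2 * d)" using d by simp
        also have "\<dots> = (norm z)\<^sup>2 / (2 * d) + d / 2 * B\<^sup>2 * (norm w)\<^sup>2 - B * norm z * norm w"
          using d by (simp add: power2_eq_square field_simps)
        finally show ?thesis by simp
      qed
      finally show "norm (dl s \<bullet> \<eta> s + l s \<bullet> (A *v \<eta> s + C *v \<omega> s))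
        \<le> (norm z)\<^sup>2 / (2 * d) + d / 2 * B\<^sup>2 * \<rho> s"
        by (simp add: \<rho>_def running_cost_def w_def)
    qed
    ultimately have "\<bar>l (p + d) \<bullet> b - l p \<bullet> a\<bar> \<le> d * ((norm z)\<^sup>2 / (2 * d)) + d / 2 * B\<^sup>2 * integral {p..p + d} \<rho>"
      using norm_has_integral_le_AE[OF i] by simp
    then have "(norm z)\<^sup>2 \<le> (norm z)\<^sup>2 / 2 + d / 2 * B\<^sup>2 * integral {p..p + d} \<rho>"
      unfolding ab(2) using d by simp
    then show "(norm (l t))\<^sup>2 \<le> d * B\<^sup>2 * integral {p..p + d} (\<lambda>s. running_cost W (x s) (u s))"
      by (simp add: z_def \<rho>_def[abs_def])
  qed
qed

section \<open>Averaging of window integrals over time\<close>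

lemma integral_shift_difference_le:
  fixes \<Psi> :: "real \<Rightarrow> real"
  assumes c: "continuous_on {\<alpha> - d..\<beta> + d} \<Psi>" and ab: "\<alpha> \<le> \<beta>" "0 \<le> d"
    and b: "\<And>t. t \<in> {\<alpha> - d..\<beta> + d} \<Longrightarrow> 0 \<le> \<Psi> t \<and> \<Psi> t \<le> M"
  shows "integral {\<alpha>..\<beta>} (\<lambda>t. \<Psi> (t + d) - \<Psi> (t - d)) \<le> 2 * d * M"
proof -
  have i: "\<Psi> integrable_on {s..t}" if "\<alpha> - d \<le> s" "t \<le> \<beta> + d" for s t
    by (rule integrable_continuous_real[OF continuous_on_subset[OF c]]) (use that in auto)
  have s1: "((\<lambda>t. \<Psi> (t + d)) has_integral integral {\<alpha> + d..\<beta> + d} \<Psi>) {\<alpha>..\<beta>}"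
    using has_integral_shift_real_ivl[OF integrable_integral[OF i[of "\<alpha> + d" "\<beta> + d"]], of d] ab by simp
  have s2: "((\<lambda>t. \<Psi> (t - d)) has_integral integral {\<alpha> - d..\<beta> - d} \<Psi>) {\<alpha>..\<beta>}"
    using has_integral_shift_real_ivl[OF integrable_integral[OF i[of "\<alpha> - d" "\<beta> - d"]], of "- d"] ab by simp
  \<comment> \<open>Each shifted integral is the integral over the whole interval less one end piece
    of length 2 d. Their difference is therefore the right end piece minus the left one, whatever
    the distance of \<alpha> and \<beta>.\<close>
  have "integral {\<alpha> - d..\<alpha> + d} \<Psi> + integral {\<alpha> + d..\<beta> + d} \<Psi> = integral {\<alpha> - d..\<beta> + d} \<Psi>"
    "integral {\<alpha> - d..\<beta> - d} \<Psi> + integral {\<beta> - d..\<beta> + d} \<Psi> = integral {\<alpha> - d..\<beta> + d} \<Psi>"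
    by (rule Henstock_Kurzweil_Integration.integral_combine; use ab i in simp)+
  moreover have "0 \<le> integral {\<alpha> - d..\<alpha> + d} \<Psi>"
    by (rule integral_nonneg) (use i b ab in auto)
  moreover have "integral {\<beta> - d..\<beta> + d} \<Psi> \<le> integral {\<beta> - d..\<beta> + d} (\<lambda>_. M)"
    by (rule integral_le) (use i b ab in auto)
  ultimately show ?thesis
    using integral_unique[OF has_integral_diff[OF s1 s2]] ab by simp
qed

text \<open>Every window lies in \<open>{t - d..t + d}\<close>, whose integral is a difference of
  values of the primitive \<Psi>. Integrating that difference over t telescopes, so the bound is
  independent of the length of \<open>{\<alpha>..\<beta>}\<close>.\<close>

lemma integral_window_le:
  fixes g \<rho> :: "real \<Rightarrow> real"
  assumes rho: "\<rho> integrable_on {0..T}" "\<And>t. 0 \<le> \<rho> t" "integral {0..T} \<rho> \<le> M"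
    and g: "g integrable_on {\<alpha>..\<beta>}" and ab: "0 \<le> \<alpha>" "\<alpha> \<le> \<beta>" "\<beta> \<le> T" and d: "0 \<le> d" and k: "0 \<le> \<kappa>"
    and w: "\<And>t. t \<in> {\<alpha>..\<beta>} \<Longrightarrow> \<exists>p. t - d \<le> p \<and> p \<le> t \<and> 0 \<le> p \<and> p + d \<le> T \<and> g t \<le> \<kappa> * integral {p..p + d} \<rho>"
  shows "integral {\<alpha>..\<beta>} g \<le> \<kappa> * (2 * d * M)"
proof -
  \<comment> \<open>Extension by zero, since \<open>{t - d..t + d}\<close> may leave
    \<open>{0..T}\<close> even though the window itself does not.\<close>
  define \<sigma> where "\<sigma> t = (if t \<in> {0..T} then \<rho> t else 0)" for t
  have sU: "\<sigma> integrable_on UNIV"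
    unfolding \<sigma>_def integrable_restrict_UNIV by (rule rho)
  have s0: "0 \<le> \<sigma> t" for t by (simp add: \<sigma>_def rho)
  have si: "\<sigma> integrable_on {s..t}" for s t
    using integrable_on_subcbox[OF sU, of s t] by simp
  have sr: "integral {s..t} \<sigma> = integral {s..t} \<rho>" if "0 \<le> s" "t \<le> T" for s t
    by (rule integral_cong) (use that in \<open>auto simp: \<sigma>_def\<close>)
  have sM: "integral {s..t} \<sigma> \<le> M" for s t
  proof -
    have "integral {s..t} \<sigma> \<le> integral UNIV \<sigma>"
      by (rule integral_subset_le) (use si sU s0 in auto)
    also have "\<dots> = integral {0..T} \<rho>"
      unfolding \<sigma>_def by (rule integral_restrict_UNIV)
    finally show ?thesis using rho(3) by simp
  qed
  define \<Psi> where "\<Psi> t = integral {\<alpha> - d..t} \<sigma>" for t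
  have c: "continuous_on {\<alpha> - d..\<beta> + d} \<Psi>"
    unfolding \<Psi>_def by (rule indefinite_integral_continuous_1[OF si])
  have comb: "integral {s..t} \<sigma> = \<Psi> t - \<Psi> s" if "\<alpha> - d \<le> s" "s \<le> t" for s t
    using Henstock_Kurzweil_Integration.integral_combine[OF that si] by (simp add: \<Psi>_def)
  have "g t \<le> \<kappa> * (\<Psi> (t + d) - \<Psi> (t - d))" if t: "t \<in> {\<alpha>..\<beta>}" for t
  proof -
    obtain p where p: "t - d \<le> p" "p \<le> t" "0 \<le> p" "p + d \<le> T" "g t \<le> \<kappa> * integral {p..p + d} \<rho>"
      using w[OF t] by blast
    have "integral {p..p + d} \<rho> = integral {p..p + d} \<sigma>" using sr p by simp
    also have "\<dots> \<le> integral {t - d..t + d} \<sigma>"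
      by (rule integral_subset_le) (use si s0 p in auto)
    also have "\<dots> = \<Psi> (t + d) - \<Psi> (t - d)" by (rule comb) (use t d in auto)
    finally show ?thesis using p(5) mult_left_mono[OF _ k] by (meson order_trans)
  qed
  moreover have cs: "continuous_on {\<alpha>..\<beta>} (\<lambda>t. \<Psi> (t + d) - \<Psi> (t - d))"
    by (intro continuous_on_diff continuous_on_compose2[OF c] continuous_intros) (use d in auto)
  ultimately have "integral {\<alpha>..\<beta>} g \<le> integral {\<alpha>..\<beta>} (\<lambda>t. \<kappa> * (\<Psi> (t + d) - \<Psi> (t - d)))"
    by (intro integral_le g integrable_continuous_real continuous_on_mult_left) auto
  also have "\<dots> = \<kappa> * integral {\<alpha>..\<beta>} (\<lambda>t. \<Psi> (t + d) - \<Psi> (t - d))"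
    by (rule integral_mult_right)
  also have "\<dots> \<le> \<kappa> * (2 * d * M)"
    by (intro mult_left_mono integral_shift_difference_le[OF c ab(2) d] k)
      (use sM si s0 in \<open>auto simp: \<Psi>_def intro: integral_nonneg\<close>)
  finally show ?thesis .
qed

text \<open>The hypothesis makes the set of steering times nonempty; the infimum of the empty set
  would carry no information.\<close>

lemma min_time_to_zero_nonneg:
  assumes "steerable A C U t a {0}"
  shows "0 \<le> min_time_to_zero A C U a"
  unfolding min_time_to_zero_def
  by (rule cInf_greatest) (use assms in \<open>auto simp: steerable_def\<close>)

text \<open>The multiplier \<open>l0\<close> is fixed before \<open>G\<close>: scaling
  \<open>l\<close> and \<open>l0\<close> by a common positive factor preserves the necessary
  conditions, so no bound uniform in \<open>l0\<close> can hold once some \<open>l\<close> is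
  nonzero on the arc. Optimality of the pair supplies the end point conditions that
  \<open>necessary_conditions\<close> leaves out.\<close>

theorem corollary3p20:
  fixes J R Q A :: "real^'n^'n" and B P C :: "real^'m^'n" and D S :: "real^'m^'m"
    and W :: "real^('n + 'm)^('n + 'm)"
    and U :: "(real^'m) set" and \<Phi> :: "(real^'n) set"
    and T1 l0 :: real
  assumes "J = - transpose J" and "psd R" and "psd Q"
    and "S = (1/2) *\<^sub>R (D + transpose D)" and "psd S"
    and "W = block_matrix (Q ** R ** Q) (Q ** P) (transpose P ** Q) S"
    and "psd W" and "W \<noteq> 0"
    and "A = (J - R) ** Q" and "C = B - P"
    and "convex U" and "compact U" and "0 \<in> interior U" and "closed \<Phi>"
    and "controllable A C"
    and "0 \<in> steerable_set A C U \<Phi>"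
    and "T1 > 0" and "steerable A C U T1 0 \<Phi>"
  shows "\<exists>G :: real^'n \<Rightarrow> real. continuous_on UNIV G \<and> (\<forall>z. 0 \<le> G z) \<and>
    (\<forall>x0 T x u l tc.
       T > min_time_to_zero A C U x0 + T1 \<longrightarrow>
       ocp_optimal A C Q W U \<Phi> x0 T x u \<longrightarrow>
       necessary_conditions A C W U T x u l l0 \<longrightarrow>
       0 < tc \<longrightarrow> tc < T / 4 \<longrightarrow>
       (AE t in lebesgue_on {tc..T - tc}. u t \<in> interior U) \<longrightarrow>
       integral {2 * tc..T - tc} (\<lambda>t. (norm (l t))\<^sup>2) \<le> G x0)"
proof -
  have U: "bounded U" using \<open>compact U\<close> by (rule compact_imp_bounded)
  note J = \<open>J = - transpose J\<close> \<open>psd R\<close> \<open>psd Q\<close> \<open>A = (J - R) ** Q\<close> \<open>controllable A C\<close> \<open>0 \<in> interior U\<close>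
  obtain F where F: "continuous_on UNIV F" "\<And>a. 0 \<le> F a"
    "\<And>a T x u. min_time_to_zero A C U a + T1 < T \<Longrightarrow> ocp_optimal A C Q W U \<Phi> a T x u \<Longrightarrow>
       integral {0..T} (\<lambda>t. running_cost W (x t) (u t)) \<le> F a"
    using optimal_running_cost_bound[OF J U \<open>steerable A C U T1 0 \<Phi>\<close>, of W] by blast
  \<comment> \<open>The interior arc has length \<open>T - 2 * tc\<close>, which exceeds T / 2 and
    hence T1 / 2 = 2 d: two windows fit into it side by side.\<close>
  define d where "d = T1 / 4"
  have d: "0 < d" using \<open>T1 > 0\<close> by (simp add: d_def)
  obtain \<kappa> where k: "0 \<le> \<kappa>"
    "\<And>\<Phi> a T x u l tc p t. necessary_conditions A C W U T x u l l0 \<Longrightarrow> ocp_admissible A C U \<Phi> a T x u \<Longrightarrow>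
       AE t in lebesgue_on {tc..T - tc}. u t \<in> interior U \<Longrightarrow> 0 \<le> tc \<Longrightarrow> tc \<le> p \<Longrightarrow> p + d \<le> T - tc \<Longrightarrow>
       t = p \<or> t = p + d \<Longrightarrow>
       (norm (l t))\<^sup>2 \<le> \<kappa> * integral {p..p + d} (\<lambda>s. running_cost W (x s) (u s))"
    using adjoint_window_bound[OF \<open>controllable A C\<close> U d, of W l0] by blast
  define G where "G a = \<kappa> * (2 * d * F a)" for a
  have "integral {2 * tc..T - tc} (\<lambda>t. (norm (l t))\<^sup>2) \<le> G x0"
    if T: "T > min_time_to_zero A C U x0 + T1" and opt: "ocp_optimal A C Q W U \<Phi> x0 T x u"
      and nc: "necessary_conditions A C W U T x u l l0" and tc: "0 < tc" "tc < T / 4"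
      and int: "AE t in lebesgue_on {tc..T - tc}. u t \<in> interior U" for x0 T x u l tc
  proof -
    have adm: "ocp_admissible A C U \<Phi> x0 T x u" using opt by (simp add: ocp_optimal_def)
    \<comment> \<open>Null controllability makes the minimal time a genuine nonnegative number,
      which turns the threshold on T into \<open>T1 < T\<close>.\<close>
    obtain t where "steerable A C U t x0 {0}" using null_controllable[OF J] by blast
    then have TT1: "T1 < T" using min_time_to_zero_nonneg T by fastforce
    obtain dl where "W11_deriv T l dl" using nc by (auto simp: necessary_conditions_def)
    then have "continuous_on {0..T} l" by (rule W11_deriv_continuous)
    then have "continuous_on {2 * tc..T - tc} (\<lambda>t. (norm (l t))\<^sup>2)"
      by (intro continuous_intros) (rule continuous_on_subset, use tc in auto)
    then have li: "(\<lambda>t. (norm (l t))\<^sup>2) integrable_on {2 * tc..T - tc}" by (rule integrable_continuous_real)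
    show ?thesis
      unfolding G_def
    proof (rule integral_window_le[OF running_cost_integrable[OF adm U] running_cost_nonneg F(3)[OF T opt] li])
      fix t assume t: "t \<in> {2 * tc..T - tc}"
      \<comment> \<open>The window looks forward from t near the left end of the arc and backward
        elsewhere. A forward window ends before \<open>tc + 2 * d\<close>, hence inside the
        arc.\<close>
      define p where "p = (if t < tc + d then t else t - d)"
      have p: "tc \<le> p" "p + d \<le> T - tc" "t = p \<or> t = p + d" "t - d \<le> p" "p \<le> t"
        using t tc TT1 d by (auto simp: p_def d_def)
      have "(norm (l t))\<^sup>2 \<le> \<kappa> * integral {p..p + d} (\<lambda>s. running_cost W (x s) (u s))"
        by (rule k(2)[OF nc adm int _ p(1-3)]) (use tc in simp)
      then show "\<exists>p. t - d \<le> p \<and> p \<le> t \<and> 0 \<le> p \<and> p + d \<le> T \<and>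
          (norm (l t))\<^sup>2 \<le> \<kappa> * integral {p..p + d} (\<lambda>s. running_cost W (x s) (u s))"
        using p tc by (intro exI[of _ p]) auto
    qed (use tc d k in auto)
  qed
  moreover have "continuous_on UNIV G" unfolding G_def by (intro continuous_intros F(1))
  moreover have "0 \<le> G a" for a using k(1) d F(2) by (simp add: G_def)
  ultimately show ?thesis by blast
qed

end
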